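(* Let $p\in\mathbb{Z}$. The Lebesgue measure is the only non-atomic $\times p$-invariant measure on $\mathbb{T}$ satisfying one of the conditions (1), (2), (3) below; that is, if a non-atomic $\times p$-invariant measure $\mu$ on $\mathbb{T}$ satisfies at least one of (1), (2), (3), then $\mu$ is the Lebesgue measure. (1) $\mu$ is ergodic (for $T_p$), and there exist a nonzero integer $l$, a F\o lner sequence $\Sigma=\{F_n\}_{n=1}^\infty$ in $\mathbb{N}$ and a set $A\subseteq\mathbb{N}$ with $D_\Sigma(A)=1$ such that $\mu$ is $\times(p^j+l)$-invariant for all $j\in A$. (2) $\mu$ is weakly mixing (for $T_p$), and there exist a nonzero integer $l$, a F\o lner sequence $\Sigma=\{F_n\}_{n=1}^\infty$ in $\mathbb{N}$ and a set $A\subseteq\mathbb{N}$ with $\overline{D}_\Sigma(A)>0$ such that $\mu$ is $\times(p^j+l)$-invariant for all $j\in A$. (3) $\mu$ is strongly mixing (for $T_p$), and there exist a nonzero integer $l$ and an infinite set $A\subseteq\mathbb{N}$ such that $\mu$ is $\times(p^j+l)$-invariant for all $j\in A$. Moreover, every $\times p$-invariant measure on $\mathbb{T}$ (not assumed non-atomic) satisfying (2) or (3) is either a Dirac measure or the Lebesgue measure.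
   Context: $\mathbb{N}$ is the set of nonnegative integers. $\mathbb{T}=\mathbb{R}/\mathbb{Z}$ is the unit circle. "Measure" always means Borel probability measure; Lebesgue measure is the normalized one on $\mathbb{T}$. A measure $\mu$ is non-atomic if $\mu\{x\}=0$ for every point $x$. For an integer $q$ the $\times q$ map is $T_q:\mathbb{T}\to\mathbb{T}$, $T_q(x)=qx \bmod \mathbb{Z}$. A measure $\mu$ is $\times q$-invariant if it is $T_q$-invariant, i.e. $\mu(T_q^{-1}B)=\mu(B)$ for all Borel $B$. For a continuous map $T:X\to X$ of a compact metrizable space, a $T$-invariant measure $\mu$ is: ergodic if every Borel $B$ with $T^{-1}B=B$ satisfies $\mu(B)^2=\mu(B)$; weakly mixing if $\mu\times\mu$ is an ergodic $T\times T$-invariant measure on $X\times X$; strongly mixing if $\lim_{j\to\infty}\mu(T^{-j}A\cap B)=\mu(A)\mu(B)$ for all Borel $A,B\subseteq X$. Here these are used with $X=\mathbb{T}$, $T=T_p$. A sequence $\Sigma=\{F_n\}_{n=1}^\infty$ of finite (nonempty) subsets of $\mathbb{N}$ is a F\o lner sequence if $\lim_{n\to\infty}\frac{|(F_n+m)\Delta F_n|}{|F_n|}=0$ for every $m\in\mathbb{N}$. For $A\subseteq\mathbb{N}$, $D_\Sigma(A)=\lim_{n\to\infty}\frac{|A\cap F_n|}{|F_n|}$ (when the limit exists; $D_\Sigma(A)=1$ means that it exists and equals $1$) and $\overline{D}_\Sigma(A)=\limsup_{n\to\infty}\frac{|A\cap F_n|}{|F_n|}$. *)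

theory Defs
  imports "HOL-Probability.Probability"
begin

section \<open>The circle \<open>\<real>/\<int>\<close>\<close>

quotient_type circle = real / "\<lambda>x y :: real. x - y \<in> \<int>"
  morphisms rep_circle to_circle
proof (rule equivpI)
  show "reflp (\<lambda>x y :: real. x - y \<in> \<int>)"
    by (simp add: reflp_def)
  show "symp (\<lambda>x y :: real. x - y \<in> \<int>)"
    using Ints_minus by (fastforce intro!: sympI)
  show "transp (\<lambda>x y :: real. x - y \<in> \<int>)"
  proof (rule transpI)
    fix x y z :: real assume "x - y \<in> \<int>" "y - z \<in> \<int>"
    then have "(x - y) + (y - z) \<in> \<int>" by (rule Ints_add)
    then show "x - z \<in> \<int>" by simp
  qed
qed

lemma to_circle_eq_iff: "to_circle x = to_circle y \<longleftrightarrow> x - y \<in> \<int>"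
  by (rule circle.abs_eq_iff)

lemma circle_exhaust: obtains x where "c = to_circle x"
  using Quotient3_abs_rep[OF Quotient3_circle, of c] that by metis

instantiation circle :: topological_space
begin

text \<open>The quotient topology.\<close>

definition open_circle :: "circle set \<Rightarrow> bool"
  where "open_circle U \<longleftrightarrow> open (to_circle -` U)"

instance
proof
  show "open (UNIV :: circle set)"
    by (simp add: open_circle_def)
  show "open (S \<inter> T)" if "open S" "open T" for S T :: "circle set"
    using that by (simp add: open_circle_def open_Int)
  show "open (\<Union>K)" if "\<forall>S\<in>K. open S" for K :: "circle set set"
    using that by (auto simp: open_circle_def vimage_Union)
qed

end

lemma continuous_to_circle: "continuous_on UNIV to_circle"
  by (auto simp: continuous_on_open_vimage open_circle_def)

lemma open_to_circle_image:
  assumes "open U" shows "open (to_circle ` U)"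
proof -
  have "to_circle -` to_circle ` U = (\<Union>n::int. (\<lambda>u. of_int n + u) ` U)"
  proof (intro set_eqI iffI)
    fix x assume "x \<in> to_circle -` to_circle ` U"
    then obtain u where u: "u \<in> U" "to_circle x = to_circle u" by auto
    then obtain n :: int where "x - u = of_int n"
      by (auto simp: to_circle_eq_iff elim: Ints_cases)
    then have "x = of_int n + u" by simp
    then show "x \<in> (\<Union>n::int. (\<lambda>u. of_int n + u) ` U)" using u by blast
  next
    fix x assume "x \<in> (\<Union>n::int. (\<lambda>u. of_int n + u) ` U)"
    then obtain n :: int and u where u: "u \<in> U" "x = of_int n + u" by auto
    then have "to_circle x = to_circle u" by (simp add: to_circle_eq_iff)
    then show "x \<in> to_circle -` to_circle ` U" using u by auto
  qed
  then show ?thesis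
    using assms by (auto simp: open_circle_def intro: open_translation)
qed

text \<open>
  The two instances below are needed for the statement to mean what it says: by second
  countability the product \<open>\<sigma>\<close>-algebra on the square of the circle is its Borel
  \<open>\<sigma>\<close>-algebra (\<open>borel_prod\<close>), and by the Hausdorff property singletons are Borel.
\<close>

instance circle :: second_countable_topology
proof
  obtain K :: "real set set" where K: "countable K" "topological_basis K"
    using ex_countable_basis[where 'a = real] by (elim exE conjE)
  have "topological_basis ((`) to_circle ` K)"
  proof (rule topological_basisI)
    fix U assume "U \<in> (`) to_circle ` K"
    then obtain W where W: "W \<in> K" "U = to_circle ` W" by (elim imageE)
    show "open U"
      unfolding W(2) by (rule open_to_circle_image[OF topological_basis_open[OF K(2) W(1)]])
  next
    fix V :: "circle set" and c assume V: "open V" "c \<in> V"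
    obtain x where x: "c = to_circle x" by (rule circle_exhaust)
    have "open (to_circle -` V)" "x \<in> to_circle -` V"
      using V(1) V(2) unfolding x open_circle_def by simp_all
    then obtain W where W: "W \<in> K" "x \<in> W" "W \<subseteq> to_circle -` V"
      by (rule topological_basisE[OF K(2)])
    then have "c \<in> to_circle ` W" "to_circle ` W \<subseteq> V"
      using x by auto
    then show "\<exists>B'\<in>(`) to_circle ` K. c \<in> B' \<and> B' \<subseteq> V"
      using W(1) by (intro bexI[of _ "to_circle ` W"] conjI imageI)
  qed
  then have "open = generate_topology ((`) to_circle ` K)"
    by (rule topological_basis_imp_subbasis)
  with countable_image[OF K(1)]
  show "\<exists>B :: circle set set. countable B \<and> open = generate_topology B"
    by (intro exI conjI)
qed

instance circle :: t2_space
proof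
  fix c d :: circle assume "c \<noteq> d"
  obtain x y where xy: "c = to_circle x" "d = to_circle y"
    using circle_exhaust[of c] circle_exhaust[of d] by metis
  define e where "e = (\<lambda>x. cis (2 * pi * x))"
  have e_eq: "e s = e t \<longleftrightarrow> to_circle s = to_circle t" for s t
  proof -
    have "e s = e t \<longleftrightarrow> sin (2 * pi * s) = sin (2 * pi * t) \<and> cos (2 * pi * s) = cos (2 * pi * t)"
      by (auto simp: e_def complex_eq_iff)
    also have "\<dots> \<longleftrightarrow> (\<exists>n::int. 2 * pi * s = 2 * pi * t + 2 * pi * n)"
      by (rule sin_cos_eq_iff)
    also have "\<dots> \<longleftrightarrow> (\<exists>n::int. 2 * pi * (s - t) = 2 * pi * n)"
      by (simp add: algebra_simps)
    also have "\<dots> \<longleftrightarrow> s - t \<in> \<int>"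
      by (auto simp: Ints_def)
    finally show ?thesis by (simp add: to_circle_eq_iff)
  qed
  have cont: "continuous_on UNIV e"
    unfolding e_def by (intro continuous_intros)
  have "e x \<noteq> e y" using \<open>c \<noteq> d\<close> xy e_eq by simp
  then obtain U V where UV: "open U" "open V" "e x \<in> U" "e y \<in> V" "U \<inter> V = {}"
    by (metis hausdorff)
  have op: "open (to_circle ` (e -` W))" if "open W" for W
    using that cont by (intro open_to_circle_image open_vimage)
  have "to_circle ` (e -` U) \<inter> to_circle ` (e -` V) = {}"
    using UV(5) by (auto simp flip: e_eq)
  then show "\<exists>U V. open U \<and> open V \<and> c \<in> U \<and> d \<in> V \<and> U \<inter> V = {}"
    using op[OF UV(1)] op[OF UV(2)] UV(3,4) xy by blast
qed

lift_definition times_map :: "int \<Rightarrow> circle \<Rightarrow> circle" is "\<lambda>q x. of_int q * x"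
proof -
  fix q :: int and x y :: real assume "x - y \<in> \<int>"
  then have "of_int q * (x - y) \<in> \<int>" by simp
  then show "of_int q * x - of_int q * y \<in> \<int>" by (simp add: right_diff_distrib)
qed

lemma continuous_times_map: "continuous_on UNIV (times_map q)"
proof -
  have "open (times_map q -` U)" if "open U" for U
  proof -
    have "to_circle -` times_map q -` U = (\<lambda>x. of_int q * x) -` (to_circle -` U)"
      by (auto simp: times_map.abs_eq)
    moreover have "open ((\<lambda>x. of_int q * x) -` (to_circle -` U))"
    proof (rule open_vimage)
      show "open (to_circle -` U)" using that by (simp add: open_circle_def)
    qed (intro continuous_intros)
    ultimately show ?thesis by (simp add: open_circle_def)
  qed
  then show ?thesis by (simp add: continuous_on_open_vimage)
qed

definition lebesgue_circle :: "circle measure"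
  where "lebesgue_circle = distr (restrict_space lborel {0..<1}) borel to_circle"


section \<open>Invariant measures\<close>

definition borel_probability :: "'a::topological_space measure \<Rightarrow> bool"
  where "borel_probability \<mu> \<longleftrightarrow> prob_space \<mu> \<and> sets \<mu> = sets borel"

definition non_atomic :: "'a measure \<Rightarrow> bool"
  where "non_atomic \<mu> \<longleftrightarrow> (\<forall>x. measure \<mu> {x} = 0)"

text \<open>
  The next notions are only used for maps that are measurable (indeed continuous) with
  respect to \<open>\<mu>\<close>, so all the preimages are measurable.
\<close>

definition invariant_measure :: "('a \<Rightarrow> 'a) \<Rightarrow> 'a measure \<Rightarrow> bool"
  where "invariant_measure T \<mu> \<longleftrightarrow>
    (\<forall>B\<in>sets \<mu>. measure \<mu> (T -` B \<inter> space \<mu>) = measure \<mu> B)"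

definition ergodic :: "('a \<Rightarrow> 'a) \<Rightarrow> 'a measure \<Rightarrow> bool"
  where "ergodic T \<mu> \<longleftrightarrow> invariant_measure T \<mu> \<and>
    (\<forall>B\<in>sets \<mu>. T -` B \<inter> space \<mu> = B \<longrightarrow> (measure \<mu> B)\<^sup>2 = measure \<mu> B)"

definition weakly_mixing :: "('a \<Rightarrow> 'a) \<Rightarrow> 'a measure \<Rightarrow> bool"
  where "weakly_mixing T \<mu> \<longleftrightarrow> invariant_measure T \<mu> \<and>
    ergodic (map_prod T T) (\<mu> \<Otimes>\<^sub>M \<mu>)"

definition strongly_mixing :: "('a \<Rightarrow> 'a) \<Rightarrow> 'a measure \<Rightarrow> bool"
  where "strongly_mixing T \<mu> \<longleftrightarrow> invariant_measure T \<mu> \<and>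
    (\<forall>A\<in>sets \<mu>. \<forall>B\<in>sets \<mu>.
      (\<lambda>j. measure \<mu> (((T ^^ j) -` A \<inter> space \<mu>) \<inter> B)) \<longlonglongrightarrow> measure \<mu> A * measure \<mu> B)"


section \<open>Folner sequences and densities\<close>

text \<open>Sequences are indexed from 1; the value at 0 is irrelevant.\<close>

definition folner_sequence :: "(nat \<Rightarrow> nat set) \<Rightarrow> bool"
  where "folner_sequence F \<longleftrightarrow> (\<forall>n\<ge>1. finite (F n) \<and> F n \<noteq> {}) \<and>
    (\<forall>m. (\<lambda>n. real (card (sym_diff ((\<lambda>k. k + m) ` F n) (F n))) / real (card (F n))) \<longlonglongrightarrow> 0)"

definition has_density :: "(nat \<Rightarrow> nat set) \<Rightarrow> nat set \<Rightarrow> real \<Rightarrow> bool"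
  where "has_density F A d \<longleftrightarrow> (\<lambda>n. real (card (A \<inter> F n)) / real (card (F n))) \<longlonglongrightarrow> d"

definition upper_density :: "(nat \<Rightarrow> nat set) \<Rightarrow> nat set \<Rightarrow> ereal"
  where "upper_density F A = limsup (\<lambda>n. ereal (real (card (A \<inter> F n)) / real (card (F n))))"


section \<open>The three conditions on an invariant measure\<close>

definition ergodic_condition :: "int \<Rightarrow> circle measure \<Rightarrow> bool"
  where "ergodic_condition p \<mu> \<longleftrightarrow> ergodic (times_map p) \<mu> \<and>
    (\<exists>l::int. \<exists>F A. l \<noteq> 0 \<and> folner_sequence F \<and> has_density F A 1 \<and>
      (\<forall>j\<in>A. invariant_measure (times_map (p ^ j + l)) \<mu>))"

definition weakly_mixing_condition :: "int \<Rightarrow> circle measure \<Rightarrow> bool"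
  where "weakly_mixing_condition p \<mu> \<longleftrightarrow> weakly_mixing (times_map p) \<mu> \<and>
    (\<exists>l::int. \<exists>F A. l \<noteq> 0 \<and> folner_sequence F \<and> upper_density F A > 0 \<and>
      (\<forall>j\<in>A. invariant_measure (times_map (p ^ j + l)) \<mu>))"

definition strongly_mixing_condition :: "int \<Rightarrow> circle measure \<Rightarrow> bool"
  where "strongly_mixing_condition p \<mu> \<longleftrightarrow> strongly_mixing (times_map p) \<mu> \<and>
    (\<exists>l::int. \<exists>A::nat set. l \<noteq> 0 \<and> infinite A \<and>
      (\<forall>j\<in>A. invariant_measure (times_map (p ^ j + l)) \<mu>))"

end

theory Submission
  imports Defs
begin

text \<open>
  Write \<open>\<mu>\<^sub>k\<close> for the \<open>k\<close>-th Fourier coefficient of \<open>\<mu>\<close>, that is, the integral of the character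
  \<open>e\<^sub>k x = exp (2 \<pi> \<i> k x)\<close>.  If \<open>\<mu>\<close> is invariant under multiplication by \<open>p\<^sup>j + l\<close>, then \<open>\<mu>\<^sub>k\<close> is the
  integral of \<open>e\<^sub>k \<circ> T\<^sup>j\<close> times \<open>e\<^sub>k\<^sub>l\<close>, where \<open>T\<close> is multiplication by \<open>p\<close>.  If \<open>T\<^sup>j\<close> decorrelates functions,
  this integral is close to \<open>\<mu>\<^sub>k \<mu>\<^sub>k\<^sub>l\<close>.  In each of the three cases \<open>A\<close> contains enough times \<open>j\<close> to
  conclude that \<open>\<mu>\<^sub>k = \<mu>\<^sub>k \<mu>\<^sub>k\<^sub>l\<close> for every \<open>k\<close>:

  \<^item> under ergodicity, correlations vanish on average along any Folner sequence (\<open>mean_ergodic\<close>), and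
    a set of density one determines the average (\<open>ergodic_condition_fourier\<close>);

  \<^item> under weak mixing, the squares of correlations vanish on average, by the mean ergodic theorem for the
    product system, so a set of positive upper density contains times of small correlation
    (\<open>weakly_mixing_imp_mixes_along\<close>);

  \<^item> under strong mixing, correlations tend to zero, so any infinite set contains such times
    (\<open>strongly_mixing_imp_mixes_along\<close>).

  Hence either \<open>\<mu>\<^sub>k = 0\<close> for all \<open>k \<noteq> 0\<close>, and \<open>\<mu>\<close> is Lebesgue measure because Fourier coefficients
  determine a measure (\<open>fourier_unique\<close>); or \<open>\<mu>\<^sub>k\<^sub>l = 1\<close> for some \<open>k \<noteq> 0\<close>, and then \<open>\<mu>\<close> is concentrated on
  finitely many roots of unity (\<open>atom_if_fourier_eq_1\<close>).  The second case is impossible for a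
  non-atomic \<open>\<mu>\<close>, and under mixing it forces a single point mass, because an atom
  decorrelates from itself only if it has full measure (\<open>atom_of_mixing_has_full_measure\<close>).
\<close>

section \<open>Averages along Folner sequences\<close>

definition average :: "(nat \<Rightarrow> nat set) \<Rightarrow> (nat \<Rightarrow> 'b::real_normed_vector) \<Rightarrow> nat \<Rightarrow> 'b"
  where "average F b n = (\<Sum>j\<in>F n. b j) /\<^sub>R real (card (F n))"

lemma folner_eventually:
  assumes "folner_sequence F"
  shows "eventually (\<lambda>n. finite (F n) \<and> F n \<noteq> {} \<and> real (card (F n)) > 0) sequentially"
  using eventually_ge_at_top[of 1]
  by eventually_elim (use assms in \<open>auto simp: folner_sequence_def card_gt_0_iff\<close>)

lemma average_add: "average F (\<lambda>j. a j + b j) n = average F a n + average F b n"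
  by (simp add: average_def sum.distrib scaleR_add_right)

lemma average_scaleR: "average F (\<lambda>j. c *\<^sub>R b j) n = c *\<^sub>R average F b n"
  by (simp add: average_def scaleR_sum_right mult.commute)

lemma norm_average_le:
  assumes "\<And>j. j \<in> F n \<Longrightarrow> norm (b j) \<le> C" "finite (F n)" "F n \<noteq> {}"
  shows "norm (average F b n) \<le> C"
proof -
  have "norm (\<Sum>j\<in>F n. b j) \<le> (\<Sum>j\<in>F n. C)" by (rule sum_norm_le) (use assms in auto)
  moreover have "real (card (F n)) > 0" using assms by (simp add: card_gt_0_iff)
  ultimately show ?thesis
    by (simp add: average_def field_simps)
qed

text \<open>
  Sums over two finite sets differ only by the terms in their symmetric difference, and for a
  Folner set and its translate this is a vanishing proportion of all terms.
\<close>

lemma average_shift: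
  fixes b :: "nat \<Rightarrow> real"
  assumes F: "folner_sequence F" and b: "\<And>j. \<bar>b j\<bar> \<le> C"
  shows "(\<lambda>n. average F (\<lambda>j. b (j + m)) n - average F b n) \<longlonglongrightarrow> 0"
proof -
  let ?D = "\<lambda>n. sym_diff ((\<lambda>k. k + m) ` F n) (F n)"
  have lim: "(\<lambda>n. C * (real (card (?D n)) / real (card (F n)))) \<longlonglongrightarrow> C * 0"
    using F by (intro tendsto_mult tendsto_const) (simp add: folner_sequence_def)
  have "eventually (\<lambda>n. norm (average F (\<lambda>j. b (j + m)) n - average F b n)
      \<le> C * (real (card (?D n)) / real (card (F n)))) sequentially"
    using folner_eventually[OF F]
  proof eventually_elim
    case (elim n)
    let ?A = "(\<lambda>k. k + m) ` F n"
    have fin: "finite ?A" "finite (F n)" using elim by auto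
    have "(\<Sum>j\<in>F n. b (j + m)) = (\<Sum>k\<in>?A. b k)"
      by (subst sum.reindex) (auto simp: inj_on_def)
    also have "\<dots> - (\<Sum>k\<in>F n. b k) = (\<Sum>k\<in>?A - F n. b k) - (\<Sum>k\<in>F n - ?A. b k)"
      using sum.Int_Diff[OF fin(1), of b "F n"] sum.Int_Diff[OF fin(2), of b ?A]
      by (simp add: Int_commute)
    also have "\<bar>\<dots>\<bar> \<le> \<bar>\<Sum>k\<in>?A - F n. b k\<bar> + \<bar>\<Sum>k\<in>F n - ?A. b k\<bar>" by linarith
    also have "\<dots> \<le> (\<Sum>k\<in>?A - F n. \<bar>b k\<bar>) + (\<Sum>k\<in>F n - ?A. \<bar>b k\<bar>)"
      by (intro add_mono sum_abs)
    also have "\<dots> = (\<Sum>k\<in>?D n. \<bar>b k\<bar>)"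
      using fin by (subst sum.union_disjoint) auto
    also have "\<dots> \<le> real (card (?D n)) * C"
      by (rule sum_bounded_above) (rule b)
    finally have "\<bar>(\<Sum>j\<in>F n. b (j + m)) - (\<Sum>k\<in>F n. b k)\<bar> \<le> C * real (card (?D n))"
      by (simp add: mult.commute)
    then have "\<bar>(\<Sum>j\<in>F n. b (j + m)) - (\<Sum>k\<in>F n. b k)\<bar> / real (card (F n))
        \<le> C * real (card (?D n)) / real (card (F n))"
      by (rule divide_right_mono) simp
    moreover have "average F (\<lambda>j. b (j + m)) n - average F b n
        = ((\<Sum>j\<in>F n. b (j + m)) - (\<Sum>k\<in>F n. b k)) / real (card (F n))"
      by (simp add: average_def divide_inverse_commute right_diff_distrib)
    ultimately show ?case by (simp add: abs_divide)
  qed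
  then show ?thesis by (rule Lim_null_comparison) (use lim in simp)
qed

text \<open>
  Times outside a set of density one carry a vanishing proportion of the weight, so a bounded
  sequence may take any values there.
\<close>

lemma average_eq_on_density_one:
  fixes b :: "nat \<Rightarrow> 'b::real_normed_vector"
  assumes F: "folner_sequence F" and A: "has_density F A 1"
    and b: "\<And>j. norm (b j) \<le> C" and c: "\<And>j. j \<in> A \<Longrightarrow> b j = c"
  shows "average F b \<longlonglongrightarrow> c"
proof -
  let ?d = "\<lambda>n. real (card (A \<inter> F n)) / real (card (F n))"
  have lim: "(\<lambda>n. (C + norm c) * (1 - ?d n)) \<longlonglongrightarrow> (C + norm c) * (1 - 1)"
    using A by (intro tendsto_intros) (simp add: has_density_def)
  have "eventually (\<lambda>n. norm (average F b n - c) \<le> (C + norm c) * (1 - ?d n)) sequentially"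
    using folner_eventually[OF F]
  proof eventually_elim
    case (elim n)
    let ?N = "real (card (F n))"
    have "average F b n - c = (\<Sum>j\<in>F n. b j - c) /\<^sub>R ?N"
      using elim by (simp add: average_def sum_subtractf scaleR_diff_right sum_constant_scaleR)
    also have "(\<Sum>j\<in>F n. b j - c) = (\<Sum>j\<in>F n - A. b j - c)"
      using elim c by (intro sum.mono_neutral_right) auto
    finally have eq: "average F b n - c = (\<Sum>j\<in>F n - A. b j - c) /\<^sub>R ?N" .
    have "norm (\<Sum>j\<in>F n - A. b j - c) \<le> (\<Sum>j\<in>F n - A. C + norm c)"
      by (rule sum_norm_le) (metis add_right_mono b norm_triangle_ineq4 order_trans)
    also have "\<dots> = (C + norm c) * real (card (F n - A))" by simp
    also have "real (card (F n - A)) = ?N - real (card (A \<inter> F n))"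
      using elim by (simp add: card_Diff_subset_Int Int_commute card_mono of_nat_diff)
    finally have "norm (average F b n - c) \<le> (C + norm c) * (?N - real (card (A \<inter> F n))) / ?N"
      unfolding eq using elim by (simp add: field_simps)
    also have "\<dots> = (C + norm c) * (1 - ?d n)"
      using elim by (simp add: field_simps)
    finally show ?case .
  qed
  then have "(\<lambda>n. average F b n - c) \<longlonglongrightarrow> 0"
    by (rule Lim_null_comparison) (use lim in simp)
  then show ?thesis by (simp add: LIM_zero_iff)
qed

text \<open>
  If the values stayed above \<open>\<eta>\<close> on \<open>A\<close>, the average would dominate \<open>\<eta>\<close> times the proportion
  of \<open>A\<close> in the Folner sets, and the upper density of \<open>A\<close> would vanish with it.
\<close>

lemma small_value_on_positive_upper_density:
  fixes b :: "nat \<Rightarrow> real"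
  assumes F: "folner_sequence F" and A: "upper_density F A > 0"
    and b: "\<And>j. b j \<ge> 0" "average F b \<longlonglongrightarrow> 0" and "\<eta> > 0"
  shows "\<exists>j\<in>A. b j < \<eta>"
proof (rule ccontr)
  assume "\<not> ?thesis"
  then have *: "\<And>j. j \<in> A \<Longrightarrow> \<eta> \<le> b j" by force
  let ?d = "\<lambda>n. real (card (A \<inter> F n)) / real (card (F n))"
  have "eventually (\<lambda>n. ?d n \<le> average F b n / \<eta>) sequentially"
    using folner_eventually[OF F]
  proof eventually_elim
    case (elim n)
    have "real (card (A \<inter> F n)) * \<eta> \<le> (\<Sum>j\<in>A \<inter> F n. b j)"
      by (rule sum_bounded_below) (use * in auto)
    also have "\<dots> \<le> (\<Sum>j\<in>F n. b j)"
      by (rule sum_mono2) (use elim b in auto)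
    finally show ?case using elim \<open>\<eta> > 0\<close>
      by (simp add: average_def field_simps)
  qed
  moreover have "(\<lambda>n. average F b n / \<eta>) \<longlonglongrightarrow> 0 / \<eta>"
    using b \<open>\<eta> > 0\<close> by (intro tendsto_intros) auto
  ultimately have "?d \<longlonglongrightarrow> 0"
    by (intro tendsto_sandwich[of "\<lambda>_. 0" ?d _ "\<lambda>n. average F b n / \<eta>"]) auto
  then have "(\<lambda>n. ereal (?d n)) \<longlonglongrightarrow> 0"
    by (simp add: zero_ereal_def)
  then have "upper_density F A = 0"
    unfolding upper_density_def by (intro lim_imp_Limsup) auto
  with A show False by simp
qed

section \<open>Measure-preserving systems\<close>

definition bounded_measurable :: "'a measure \<Rightarrow> ('a \<Rightarrow> 'b::real_normed_vector) \<Rightarrow> bool"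
  where "bounded_measurable M f \<longleftrightarrow>
    f \<in> borel_measurable M \<and> (\<exists>B. \<forall>x\<in>space M. norm (f x) \<le> B)"

lemma bounded_measurableE:
  assumes "bounded_measurable M f"
  obtains B where "f \<in> borel_measurable M" "\<And>x. x \<in> space M \<Longrightarrow> norm (f x) \<le> B" "B \<ge> 0"
proof -
  obtain B where B: "\<And>x. x \<in> space M \<Longrightarrow> norm (f x) \<le> B"
    using assms by (auto simp: bounded_measurable_def)
  show ?thesis
  proof (rule that[of "max B 0"])
    show "norm (f x) \<le> max B 0" if "x \<in> space M" for x
      using B[OF that] by simp
  qed (use assms in \<open>auto simp: bounded_measurable_def\<close>)
qed

lemma bounded_measurable_mult:
  fixes f g :: "'a \<Rightarrow> 'b::{real_normed_algebra, second_countable_topology}"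
  assumes "bounded_measurable M f" "bounded_measurable M g"
  shows "bounded_measurable M (\<lambda>x. f x * g x)"
proof -
  obtain B C where B: "f \<in> borel_measurable M" "\<And>x. x \<in> space M \<Longrightarrow> norm (f x) \<le> B" "B \<ge> 0"
    and C: "g \<in> borel_measurable M" "\<And>x. x \<in> space M \<Longrightarrow> norm (g x) \<le> C" "C \<ge> 0"
    using assms by (metis bounded_measurableE)
  have "norm (f x * g x) \<le> B * C" if "x \<in> space M" for x
    using norm_mult_ineq[of "f x" "g x"] mult_mono[OF B(2)[OF that] C(2)[OF that]] B(3) by force
  then show ?thesis using B C unfolding bounded_measurable_def by auto
qed

lemma (in finite_measure) bounded_measurable_integrable:
  fixes f :: "'a \<Rightarrow> 'b::{banach, second_countable_topology}"
  assumes "bounded_measurable M f" shows "integrable M f"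
proof -
  obtain B where "f \<in> borel_measurable M" "\<And>x. x \<in> space M \<Longrightarrow> norm (f x) \<le> B" "B \<ge> 0"
    using bounded_measurableE[OF assms] by metis
  then show ?thesis by (intro integrable_const_bound[of _ B]) auto
qed

lemma norm_integral_le:
  fixes f :: "'a \<Rightarrow> 'b::{banach, second_countable_topology}"
  assumes "integrable M f" "integrable M g" "\<And>x. x \<in> space M \<Longrightarrow> norm (f x) \<le> g x"
  shows "norm (LINT x|M. f x) \<le> (LINT x|M. g x)"
  using integral_norm_bound[of M f] integral_mono[OF integrable_norm[OF assms(1)] assms(2,3)]
  by linarith

text \<open>
  The product of the means is subtracted so that mixing and ergodicity both say that correlations
  tend to zero, in their respective sense.  No conjugate is put on \<open>g\<close>: the correlation is
  bilinear, and for two characters it is again a difference of Fourier coefficients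
  (\<open>correlation_characters\<close>).
\<close>

definition correlation ::
  "'a measure \<Rightarrow> ('a \<Rightarrow> 'a) \<Rightarrow> ('a \<Rightarrow> 'b) \<Rightarrow> ('a \<Rightarrow> 'b) \<Rightarrow> nat
    \<Rightarrow> 'b::{real_normed_field, banach, second_countable_topology}"
  where "correlation M T f g j =
    (LINT x|M. f ((T ^^ j) x) * g x) - (LINT x|M. f x) * (LINT x|M. g x)"

locale measure_preserving_system = prob_space M for M :: "'a measure" +
  fixes T :: "'a \<Rightarrow> 'a"
  assumes T_measurable [measurable]: "T \<in> measurable M M"
    and T_invariant: "invariant_measure T M"
begin

lemma distr_iterate: "distr M M (T ^^ j) = M"
proof (induction j)
  case 0
  then show ?case by (simp add: id_def distr_id)
next
  case (Suc j)
  have step: "distr M M T = M"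
  proof (rule measure_eqI)
    fix B assume "B \<in> sets (distr M M T)"
    then show "emeasure (distr M M T) B = emeasure M B"
      using T_invariant by (simp add: emeasure_distr emeasure_eq_measure invariant_measure_def)
  qed simp
  have "distr M M (T ^^ Suc j) = distr (distr M M (T ^^ j)) M T"
    by (subst distr_distr) auto
  then show ?case by (simp only: Suc step)
qed

lemma iterate_in_space: "x \<in> space M \<Longrightarrow> (T ^^ j) x \<in> space M"
  by (rule measurable_space[OF measurable_compose_n[OF T_measurable]])

lemma integral_iterate:
  fixes f :: "'a \<Rightarrow> 'b::{banach, second_countable_topology}"
  assumes "f \<in> borel_measurable M"
  shows "(LINT x|M. f ((T ^^ j) x)) = (LINT x|M. f x)"
  using integral_distr[of "T ^^ j" M M f] assms by (simp add: distr_iterate)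

lemma integrable_iterate:
  fixes f :: "'a \<Rightarrow> 'b::{banach, second_countable_topology}"
  assumes "integrable M f"
  shows "integrable M (\<lambda>x. f ((T ^^ j) x))"
  using integrable_distr[of "T ^^ j" M M f] assms by (simp add: distr_iterate)

lemma AE_iterate:
  assumes "AE x in M. P x" shows "AE x in M. P ((T ^^ j) x)"
proof -
  have "AE x in distr M M (T ^^ j). P x" unfolding distr_iterate by (rule assms)
  from AE_distrD[OF measurable_compose_n[OF T_measurable] this] show ?thesis .
qed

lemma bounded_measurable_iterate:
  fixes f :: "'a \<Rightarrow> 'b::{banach, second_countable_topology}"
  assumes "bounded_measurable M f"
  shows "bounded_measurable M (\<lambda>x. f ((T ^^ j) x))"
  using assms iterate_in_space unfolding bounded_measurable_def
  by (auto intro: measurable_compose[OF measurable_compose_n[OF T_measurable]])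

text \<open>
  Approximation arguments vary either factor in \<open>L\<^sup>1\<close> while the other one stays bounded; this
  statement and the next three are the two versions of the estimates that they need.
\<close>

lemma integrable_correlation_left:
  fixes f g :: "'a \<Rightarrow> 'b::{real_normed_field, banach, second_countable_topology}"
  assumes "integrable M f" "bounded_measurable M g"
  shows "integrable M (\<lambda>x. f ((T ^^ j) x) * g x)"
proof -
  obtain C where C: "g \<in> borel_measurable M" "\<And>x. x \<in> space M \<Longrightarrow> norm (g x) \<le> C" "C \<ge> 0"
    using bounded_measurableE[OF assms(2)] by metis
  note [measurable] = C(1) borel_measurable_integrable[OF assms(1)]
  show ?thesis
  proof (rule Bochner_Integration.integrable_bound)
    show "integrable M (\<lambda>x. norm (f ((T ^^ j) x)) * C)"
      by (intro integrable_mult_left integrable_norm integrable_iterate assms)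
    show "AE x in M. norm (f ((T ^^ j) x) * g x) \<le> norm (norm (f ((T ^^ j) x)) * C)"
      using C by (auto simp: norm_mult intro!: AE_I2 mult_left_mono)
  qed simp
qed

lemma integrable_correlation_right:
  fixes f g :: "'a \<Rightarrow> 'b::{real_normed_field, banach, second_countable_topology}"
  assumes "bounded_measurable M f" "integrable M g"
  shows "integrable M (\<lambda>x. f ((T ^^ j) x) * g x)"
proof -
  obtain C where C: "f \<in> borel_measurable M" "\<And>x. x \<in> space M \<Longrightarrow> norm (f x) \<le> C" "C \<ge> 0"
    using bounded_measurableE[OF assms(1)] by metis
  note [measurable] = C(1) borel_measurable_integrable[OF assms(2)]
  show ?thesis
  proof (rule Bochner_Integration.integrable_bound)
    show "integrable M (\<lambda>x. C * norm (g x))"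
      by (intro integrable_mult_right integrable_norm assms)
    show "AE x in M. norm (f ((T ^^ j) x) * g x) \<le> norm (C * norm (g x))"
      using C by (auto simp: norm_mult iterate_in_space intro!: AE_I2 mult_right_mono)
  qed simp
qed

lemma correlation_le_L1_left:
  fixes f g :: "'a \<Rightarrow> 'b::{real_normed_field, banach, second_countable_topology}"
  assumes f: "integrable M f" and g: "g \<in> borel_measurable M"
    and C: "\<And>x. x \<in> space M \<Longrightarrow> norm (g x) \<le> C"
  shows "norm (correlation M T f g j) \<le> 2 * C * (LINT x|M. norm (f x))"
proof -
  have bg: "bounded_measurable M g" using g C by (auto simp: bounded_measurable_def)
  have C0: "C \<ge> 0" using C not_empty norm_ge_zero order_trans by blast
  have "norm (LINT x|M. f ((T ^^ j) x) * g x) \<le> (LINT x|M. norm (f ((T ^^ j) x)) * C)"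
    using C integrable_correlation_left[OF f bg, of j] integrable_iterate[OF f, of j]
    by (intro norm_integral_le integrable_mult_left integrable_norm)
       (auto simp: norm_mult intro!: mult_left_mono)
  also have "\<dots> = (LINT x|M. norm (f x)) * C"
    using integral_iterate[of "\<lambda>x. norm (f x)" j] borel_measurable_integrable[OF f] by simp
  finally have 1: "norm (LINT x|M. f ((T ^^ j) x) * g x) \<le> C * (LINT x|M. norm (f x))"
    by (simp add: mult.commute)
  have "norm (LINT x|M. g x) \<le> (LINT x|M. C)"
    using C bounded_measurable_integrable[OF bg] by (intro norm_integral_le) auto
  then have 2: "norm ((LINT x|M. f x) * (LINT x|M. g x)) \<le> (LINT x|M. norm (f x)) * C"
    unfolding norm_mult by (intro mult_mono integral_norm_bound) (auto simp: prob_space)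
  show ?thesis unfolding correlation_def
    using norm_triangle_ineq4[of "LINT x|M. f ((T ^^ j) x) * g x" "(LINT x|M. f x) * (LINT x|M. g x)"] 1 2
    by (simp add: mult.commute)
qed

lemma correlation_le_L1_right:
  fixes f g :: "'a \<Rightarrow> 'b::{real_normed_field, banach, second_countable_topology}"
  assumes f: "f \<in> borel_measurable M" and g: "integrable M g"
    and C: "\<And>x. x \<in> space M \<Longrightarrow> norm (f x) \<le> C"
  shows "norm (correlation M T f g j) \<le> 2 * C * (LINT x|M. norm (g x))"
proof -
  have C0: "C \<ge> 0" using C not_empty norm_ge_zero order_trans by blast
  have bf: "bounded_measurable M f" using f C by (auto simp: bounded_measurable_def)
  have "norm (f ((T ^^ j) x) * g x) \<le> C * norm (g x)" if "x \<in> space M" for x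
    using C[OF iterate_in_space[OF that, of j]] by (simp add: norm_mult mult_right_mono)
  then have "norm (LINT x|M. f ((T ^^ j) x) * g x) \<le> (LINT x|M. C * norm (g x))"
    using g by (intro norm_integral_le integrable_correlation_right bf integrable_mult_right integrable_norm)
  then have 1: "norm (LINT x|M. f ((T ^^ j) x) * g x) \<le> C * (LINT x|M. norm (g x))" by simp
  have "norm (LINT x|M. f x) \<le> (LINT x|M. C)"
    using C bounded_measurable_integrable[OF bf] by (intro norm_integral_le) auto
  then have 2: "norm ((LINT x|M. f x) * (LINT x|M. g x)) \<le> C * (LINT x|M. norm (g x))"
    unfolding norm_mult by (intro mult_mono integral_norm_bound) (auto simp: prob_space C0)
  show ?thesis unfolding correlation_def
    using norm_triangle_ineq4[of "LINT x|M. f ((T ^^ j) x) * g x" "(LINT x|M. f x) * (LINT x|M. g x)"] 1 2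
    by simp
qed

end

section \<open>The mean ergodic theorem\<close>

context measure_preserving_system
begin

lemma correlation_minus_const:
  fixes f g :: "'a \<Rightarrow> 'b::{real_normed_field, banach, second_countable_topology}"
  assumes f: "integrable M f" and g: "bounded_measurable M g"
  shows "correlation M T (\<lambda>x. f x - c) g j = correlation M T f g j"
  using integrable_correlation_left[OF f g, of j] bounded_measurable_integrable[OF g] f
  by (simp add: correlation_def left_diff_distrib prob_space)

text \<open>
  By monotone convergence the series of absolute values has a finite integral.
\<close>

lemma AE_summable_if_summable_L1_norms:
  fixes u :: "nat \<Rightarrow> 'a \<Rightarrow> real"
  assumes u: "\<And>m. integrable M (u m)" and c: "summable c" "\<And>m. (LINT x|M. \<bar>u m x\<bar>) \<le> c m"
  shows "AE x in M. summable (\<lambda>m. u m x)"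
proof -
  note [measurable] = borel_measurable_integrable[OF u]
  have c0: "0 \<le> c m" for m
    using c(2)[of m] Bochner_Integration.integral_nonneg[of M "\<lambda>x. \<bar>u m x\<bar>"] by linarith
  have "(\<integral>\<^sup>+x. (\<Sum>m. ennreal \<bar>u m x\<bar>) \<partial>M) = (\<Sum>m. \<integral>\<^sup>+x. ennreal \<bar>u m x\<bar> \<partial>M)"
    by (rule nn_integral_suminf) simp
  also have "\<dots> = (\<Sum>m. ennreal (LINT x|M. \<bar>u m x\<bar>))"
    by (intro suminf_cong nn_integral_eq_integral integrable_abs u) auto
  also have "\<dots> \<le> (\<Sum>m. ennreal (c m))"
    by (intro suminf_le ennreal_leI c) auto
  also have "\<dots> = ennreal (\<Sum>m. c m)" by (rule suminf_ennreal2[OF c0 c(1)])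
  also have "\<dots> < \<infinity>" by simp
  finally have "AE x in M. (\<Sum>m. ennreal \<bar>u m x\<bar>) \<noteq> \<infinity>"
    by (intro nn_integral_PInf_AE) auto
  then show ?thesis
  proof eventually_elim
    case (elim x)
    then have "summable (\<lambda>m. \<bar>u m x\<bar>)" by (intro summable_suminf_not_top) auto
    then show ?case by (rule summable_rabs_cancel)
  qed
qed

text \<open>
  The definition of ergodicity only speaks of sets that are invariant everywhere, whereas \<open>h\<close> is
  invariant almost everywhere.  The set of points whose orbit satisfies \<open>h > a\<close> infinitely often is
  strictly invariant, and it agrees with \<open>{h > a}\<close> up to a null set.  For \<open>a\<close> the mean of \<open>h\<close>, one
  of the functions \<open>a - h\<close> and \<open>h - a\<close> is then nonnegative almost everywhere with integral zero.
\<close>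

lemma ergodic_AE_constant:
  fixes h :: "'a \<Rightarrow> real"
  assumes erg: "ergodic T M" and h: "integrable M h" and inv: "AE x in M. h (T x) = h x"
  shows "AE x in M. h x = (LINT x|M. h x)"
proof -
  define a where "a = (LINT x|M. h x)"
  note [measurable] = borel_measurable_integrable[OF h]
  define B where "B = {x \<in> space M. \<forall>m. \<exists>n\<ge>m. h ((T ^^ n) x) > a}"
  have [measurable]: "B \<in> sets M" unfolding B_def by measurable
  have "T -` B \<inter> space M = B"
  proof (rule set_eqI)
    fix x
    have "(\<forall>m. \<exists>n\<ge>m. h ((T ^^ n) (T x)) > a) \<longleftrightarrow> (\<forall>m. \<exists>n\<ge>m. h ((T ^^ n) x) > a)"
    proof
      assume L: "\<forall>m. \<exists>n\<ge>m. h ((T ^^ n) (T x)) > a"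
      show "\<forall>m. \<exists>n\<ge>m. h ((T ^^ n) x) > a"
      proof
        fix m
        obtain n where "n \<ge> m" "h ((T ^^ n) (T x)) > a" using L by blast
        then show "\<exists>n\<ge>m. h ((T ^^ n) x) > a"
          by (intro exI[of _ "Suc n"]) (simp add: funpow_swap1)
      qed
    next
      assume R: "\<forall>m. \<exists>n\<ge>m. h ((T ^^ n) x) > a"
      show "\<forall>m. \<exists>n\<ge>m. h ((T ^^ n) (T x)) > a"
      proof
        fix m
        obtain n where "n \<ge> Suc m" "h ((T ^^ n) x) > a" using R by blast
        then show "\<exists>n\<ge>m. h ((T ^^ n) (T x)) > a"
          by (intro exI[of _ "n - 1"]) (cases n, auto simp: funpow_swap1)
      qed
    qed
    then show "x \<in> T -` B \<inter> space M \<longleftrightarrow> x \<in> B"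
      using measurable_space[OF T_measurable] by (auto simp: B_def)
  qed
  then have "(prob B)\<^sup>2 = prob B" using erg by (simp add: ergodic_def)
  then have prob_B: "prob B = 0 \<or> prob B = 1" by (simp add: power2_eq_square)
  have "AE x in M. \<forall>n. h (T ((T ^^ n) x)) = h ((T ^^ n) x)"
    unfolding AE_all_countable by (intro allI AE_iterate inv)
  then have AE_B: "AE x in M. x \<in> B \<longleftrightarrow> h x > a"
    using AE_space
  proof eventually_elim
    case (elim x)
    have "h ((T ^^ n) x) = h x" for n by (induction n) (use elim in auto)
    then show ?case using elim by (auto simp: B_def)
  qed
  from prob_B show ?thesis
  proof
    assume "prob B = 0"
    then have "AE x in M. x \<notin> B"
      by (intro AE_not_in) (simp add: null_sets_def emeasure_eq_measure)
    with AE_B have *: "AE x in M. 0 \<le> a - h x" by eventually_elim auto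
    have "(LINT x|M. a - h x) = 0" using h by (simp add: a_def prob_space)
    then have "AE x in M. a - h x = 0"
      using integral_nonneg_eq_0_iff_AE[OF _ *] h by simp
    then show ?thesis unfolding a_def by eventually_elim simp
  next
    assume "prob B = 1"
    then have "AE x in M. x \<in> B" by (rule AE_prob_1)
    with AE_B have *: "AE x in M. 0 \<le> h x - a" by eventually_elim auto
    have "(LINT x|M. h x - a) = 0" using h by (simp add: a_def prob_space)
    then have "AE x in M. h x - a = 0"
      using integral_nonneg_eq_0_iff_AE[OF _ *] h by simp
    then show ?thesis unfolding a_def by eventually_elim simp
  qed
qed

end

text \<open>
  The part of the convex hull of the orbit \<open>f, f \<circ> T, f \<circ> T\<^sup>2, \<dots>\<close> that is reached with dyadic
  weights.  Midpoints are all that the parallelogram law uses.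
\<close>

inductive_set orbit_hull :: "('a \<Rightarrow> 'a) \<Rightarrow> ('a \<Rightarrow> real) \<Rightarrow> ('a \<Rightarrow> real) set"
  for T f where
  iterate: "(\<lambda>x. f ((T ^^ i) x)) \<in> orbit_hull T f"
| midpoint: "g \<in> orbit_hull T f \<Longrightarrow> h \<in> orbit_hull T f
    \<Longrightarrow> (\<lambda>x. (g x + h x) / 2) \<in> orbit_hull T f"

lemma orbit_hull_shift: "g \<in> orbit_hull T f \<Longrightarrow> (\<lambda>x. g (T x)) \<in> orbit_hull T f"
proof (induction rule: orbit_hull.induct)
  case (iterate i)
  show ?case using orbit_hull.iterate[where T = T and f = f and i = "Suc i"] by (simp add: funpow_swap1)
next
  case (midpoint g h)
  then show ?case using orbit_hull.midpoint by fastforce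
qed

context measure_preserving_system
begin

lemma orbit_hull_bounded:
  assumes f: "f \<in> borel_measurable M" "\<And>x. x \<in> space M \<Longrightarrow> \<bar>f x\<bar> \<le> B"
    and g: "g \<in> orbit_hull T f"
  shows "g \<in> borel_measurable M \<and> (\<forall>x\<in>space M. \<bar>g x\<bar> \<le> B) \<and> (LINT x|M. g x) = (LINT x|M. f x)"
  using g
proof (induction rule: orbit_hull.induct)
  case (iterate i)
  then show ?case
    using f iterate_in_space integral_iterate[OF f(1)]
    by (auto intro: measurable_compose[OF measurable_compose_n[OF T_measurable]])
next
  case (midpoint g h)
  then have "integrable M g" "integrable M h"
    by (auto intro!: integrable_const_bound[of _ B])
  moreover have "\<bar>(g x + h x) / 2\<bar> \<le> B" if "x \<in> space M" for x
  proof -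
    have "\<bar>g x\<bar> \<le> B" "\<bar>h x\<bar> \<le> B" using midpoint that by auto
    then show ?thesis by (simp add: abs_le_iff field_simps)
  qed
  ultimately show ?case using midpoint by auto
qed

text \<open>
  A shift in time does not change averages along a Folner sequence asymptotically, hence neither
  does replacing \<open>f\<close> by a function that mixes its translates.
\<close>

lemma average_correlation_orbit_hull:
  assumes F: "folner_sequence F" and f: "bounded_measurable M f" and w: "bounded_measurable M w"
    and g: "g \<in> orbit_hull T f"
  shows "(\<lambda>n. average F (correlation M T g w) n - average F (correlation M T f w) n) \<longlonglongrightarrow> 0"
  using g
proof (induction rule: orbit_hull.induct)
  case (iterate i)
  obtain C where C: "w \<in> borel_measurable M" "\<And>x. x \<in> space M \<Longrightarrow> norm (w x) \<le> C"
    by (metis bounded_measurableE w)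
  have shift: "correlation M T (\<lambda>x. f ((T ^^ i) x)) w = (\<lambda>j. correlation M T f w (j + i))"
    using integral_iterate[of f i] f
    by (auto simp: correlation_def fun_eq_iff funpow_add add.commute[of _ i] bounded_measurable_def)
  have "\<bar>correlation M T f w j\<bar> \<le> 2 * C * (LINT x|M. norm (f x))" for j
    using correlation_le_L1_left[OF bounded_measurable_integrable[OF f] C] by simp
  then show ?case unfolding shift by (rule average_shift[OF F])
next
  case (midpoint g h)
  obtain B where B: "f \<in> borel_measurable M" "\<And>x. x \<in> space M \<Longrightarrow> norm (f x) \<le> B"
    by (metis bounded_measurableE f)
  have gh: "bounded_measurable M g" "bounded_measurable M h"
    using orbit_hull_bounded[of f B] B midpoint.hyps by (auto simp: bounded_measurable_def)
  have int: "integrable M g" "integrable M h"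
    using gh by (auto intro: bounded_measurable_integrable)
  have corr: "correlation M T (\<lambda>x. (g x + h x) / 2) w j
      = (1/2) *\<^sub>R correlation M T g w j + (1/2) *\<^sub>R correlation M T h w j" for j
  proof -
    have "(\<lambda>x. (g ((T ^^ j) x) + h ((T ^^ j) x)) / 2 * w x)
        = (\<lambda>x. (g ((T ^^ j) x) * w x + h ((T ^^ j) x) * w x) / 2)"
      by (simp add: fun_eq_iff algebra_simps)
    then show ?thesis
      using integrable_correlation_left[OF int(1) w, of j] integrable_correlation_left[OF int(2) w, of j] int
      by (simp add: correlation_def) (simp add: field_simps)
  qed
  have "average F (correlation M T (\<lambda>x. (g x + h x) / 2) w) n - average F (correlation M T f w) n
      = (1/2) * (average F (correlation M T g w) n - average F (correlation M T f w) n)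
      + (1/2) * (average F (correlation M T h w) n - average F (correlation M T f w) n)" for n
  proof -
    have "average F (correlation M T (\<lambda>x. (g x + h x) / 2) w) n
        = (1/2) *\<^sub>R average F (correlation M T g w) n + (1/2) *\<^sub>R average F (correlation M T h w) n"
      unfolding corr[abs_def] average_add average_scaleR ..
    then show ?thesis by (simp add: field_simps)
  qed
  moreover have "(\<lambda>n. (1/2) * (average F (correlation M T g w) n - average F (correlation M T f w) n)
      + (1/2) * (average F (correlation M T h w) n - average F (correlation M T f w) n))
      \<longlonglongrightarrow> (1/2) * 0 + (1/2) * 0"
    by (intro tendsto_intros midpoint.IH)
  ultimately show ?case by simp
qed

text \<open>
  Integrate \<open>2 \<bar>u\<bar> \<le> u\<^sup>2 / s + s\<close>.
\<close>

lemma L1_le_if_L2_le: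
  fixes u :: "'a \<Rightarrow> real"
  assumes u: "bounded_measurable M u" and s: "s > 0" and L2: "(LINT x|M. (u x)\<^sup>2) \<le> s\<^sup>2"
  shows "(LINT x|M. \<bar>u x\<bar>) \<le> s"
proof -
  have int2: "integrable M (\<lambda>x. (u x)\<^sup>2)"
    unfolding power2_eq_square by (intro bounded_measurable_integrable bounded_measurable_mult u)
  have "\<bar>u x\<bar> \<le> ((u x)\<^sup>2 / s + s) / 2" for x
  proof -
    have "0 \<le> (\<bar>u x\<bar> - s)\<^sup>2" by simp
    then have "2 * \<bar>u x\<bar> * s \<le> (u x)\<^sup>2 + s * s" by (simp add: power2_eq_square algebra_simps)
    then show ?thesis using s by (simp add: field_simps)
  qed
  then have "(LINT x|M. \<bar>u x\<bar>) \<le> (LINT x|M. ((u x)\<^sup>2 / s + s) / 2)"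
    using int2 bounded_measurable_integrable[OF u] by (intro integral_mono) auto
  also have "\<dots> = ((LINT x|M. (u x)\<^sup>2) / s + s) / 2"
    using int2 by (simp add: prob_space)
  also have "\<dots> \<le> (s\<^sup>2 / s + s) / 2"
    using L2 s by (intro divide_right_mono add_right_mono) auto
  finally show ?thesis using s by (simp add: power2_eq_square)
qed

text \<open>
  The von Neumann mean ergodic theorem in its geometric form: the element of least \<open>L\<^sup>2\<close> norm in
  the closed convex hull of an orbit is unique, hence invariant, hence constant by ergodicity.
  The minimizing sequence \<open>g\<close> is chosen so close to the infimum that its increments are summable
  in \<open>L\<^sup>1\<close>, which makes it converge almost everywhere; the limit is the minimal element.
\<close>

lemma orbit_hull_L1_near_mean:
  fixes f :: "'a \<Rightarrow> real"
  assumes erg: "ergodic T M" and f: "bounded_measurable M f" and "e > 0"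
  shows "\<exists>g\<in>orbit_hull T f. (LINT x|M. \<bar>g x - (LINT x|M. f x)\<bar>) < e"
proof -
  obtain B where B: "f \<in> borel_measurable M" "\<And>x. x \<in> space M \<Longrightarrow> norm (f x) \<le> B" "B \<ge> 0"
    by (metis bounded_measurableE f)
  let ?K = "orbit_hull T f"
  have K: "g \<in> borel_measurable M" "\<And>x. x \<in> space M \<Longrightarrow> \<bar>g x\<bar> \<le> B"
    "(LINT x|M. g x) = (LINT x|M. f x)" "bounded_measurable M g" if "g \<in> ?K" for g
    using orbit_hull_bounded[of f B, OF B(1) _ that] B(2) by (auto simp: bounded_measurable_def)
  define E where "E g = (LINT x|M. (g x)\<^sup>2)" for g :: "'a \<Rightarrow> real"
  define d where "d = (INF g\<in>?K. E g)"
  have bdd: "bdd_below (E ` ?K)"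
    by (rule bdd_belowI[of _ 0]) (auto simp: E_def)
  have ne: "?K \<noteq> {}" using orbit_hull.iterate by blast
  have d_le: "d \<le> E g" if "g \<in> ?K" for g
    unfolding d_def using bdd that by (rule cINF_lower)
  \<comment> \<open>by the parallelogram law, two almost minimal elements are close, since their midpoint
      cannot beat the infimum\<close>
  have close: "(LINT x|M. \<bar>g x - h x\<bar>) \<le> 2 * s"
    if gh: "g \<in> ?K" "h \<in> ?K" and s: "s > 0" "E g \<le> d + s\<^sup>2" "E h \<le> d + s\<^sup>2" for g h s
  proof (rule L1_le_if_L2_le)
    note [measurable] = K(1)[OF gh(1)] K(1)[OF gh(2)]
    have "\<bar>g x - h x\<bar> \<le> 2 * B" if "x \<in> space M" for x
      using K(2)[OF gh(1) that] K(2)[OF gh(2) that] by linarith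
    then show "bounded_measurable M (\<lambda>x. g x - h x)"
      by (auto simp: bounded_measurable_def)
    have int: "integrable M (\<lambda>x. (g x)\<^sup>2)" "integrable M (\<lambda>x. (h x)\<^sup>2)" "integrable M (\<lambda>x. g x * h x)"
      unfolding power2_eq_square
      by (intro bounded_measurable_integrable bounded_measurable_mult K(4) gh)+
    have "d \<le> E (\<lambda>x. (g x + h x) / 2)"
      by (intro d_le orbit_hull.midpoint gh)
    also have "\<dots> = (LINT x|M. ((g x)\<^sup>2 + (h x)\<^sup>2 + 2 * (g x * h x)) / 4)"
      unfolding E_def by (intro Bochner_Integration.integral_cong refl)
        (simp add: power2_eq_square field_simps)
    also have "\<dots> = (E g + E h + 2 * (LINT x|M. g x * h x)) / 4"
      using int by (simp add: E_def)
    finally have *: "4 * d \<le> E g + E h + 2 * (LINT x|M. g x * h x)" by simp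
    have "(LINT x|M. (g x - h x)\<^sup>2) = (LINT x|M. (g x)\<^sup>2 + (h x)\<^sup>2 - 2 * (g x * h x))"
      by (intro Bochner_Integration.integral_cong refl) (simp add: power2_eq_square algebra_simps)
    also have "\<dots> = E g + E h - 2 * (LINT x|M. g x * h x)"
      using int by (simp add: E_def)
    also have "\<dots> \<le> (2 * s)\<^sup>2" using * s by (simp add: power2_eq_square)
    finally show "(LINT x|M. (g x - h x)\<^sup>2) \<le> (2 * s)\<^sup>2" .
  qed (use s in simp)
  have "\<exists>g\<in>?K. E g \<le> d + ((1/2) ^ m)\<^sup>2" for m :: nat
  proof -
    have "d < d + ((1/2) ^ m)\<^sup>2" by simp
    then have "\<exists>g\<in>?K. E g < d + ((1/2) ^ m)\<^sup>2"
      unfolding d_def by (subst (asm) cINF_less_iff[OF ne bdd]) 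
    then show ?thesis by (meson less_imp_le)
  qed
  then obtain g where g: "\<And>m. g m \<in> ?K" "\<And>m. E (g m) \<le> d + ((1/2) ^ m)\<^sup>2" by metis
  note [measurable] = K(1)[OF g(1)]
  have int_g: "integrable M (g m)" for m by (rule bounded_measurable_integrable[OF K(4)[OF g(1)]])
  have gT: "(\<lambda>x. g m (T x)) \<in> ?K" "E (\<lambda>x. g m (T x)) \<le> d + ((1/2) ^ m)\<^sup>2" for m
  proof -
    show "(\<lambda>x. g m (T x)) \<in> ?K" by (rule orbit_hull_shift[OF g(1)])
    have "E (\<lambda>x. g m (T x)) = E (g m)"
      unfolding E_def using integral_iterate[of "\<lambda>x. (g m x)\<^sup>2" 1] by simp
    then show "E (\<lambda>x. g m (T x)) \<le> d + ((1/2) ^ m)\<^sup>2" using g(2) by simp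
  qed
  have summ: "summable (\<lambda>m. 2 * (1/2) ^ m :: real)" by (intro summable_mult summable_geometric) simp
  have "AE x in M. summable (\<lambda>m. g (Suc m) x - g m x)"
  proof (rule AE_summable_if_summable_L1_norms[OF _ summ])
    fix m
    have "((1/2) ^ Suc m)\<^sup>2 \<le> (((1/2) ^ m)\<^sup>2 :: real)" by (intro power_mono power_decreasing) auto
    then have "E (g (Suc m)) \<le> d + ((1/2) ^ m)\<^sup>2" using g(2)[of "Suc m"] by linarith
    then show "(LINT x|M. \<bar>g (Suc m) x - g m x\<bar>) \<le> 2 * (1/2) ^ m"
      using g by (intro close) auto
  qed (use int_g in auto)
  then have conv: "AE x in M. convergent (\<lambda>m. g m x)"
  proof eventually_elim
    case (elim x)
    then have "convergent (\<lambda>n. \<Sum>m<n. g (Suc m) x - g m x)" by (simp add: summable_iff_convergent)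
    then have "convergent (\<lambda>n. g n x - g 0 x)" by (simp add: sum_lessThan_telescope[of "\<lambda>n. g n x"])
    from convergent_add[OF this convergent_const[of "g 0 x"]] show ?case by simp
  qed
  define h where "h x = lim (\<lambda>m. g m x)" for x
  have h_meas [measurable]: "h \<in> borel_measurable M"
    unfolding h_def by (rule borel_measurable_lim_metric) simp
  have lim: "AE x in M. (\<lambda>m. g m x) \<longlonglongrightarrow> h x"
    using conv by eventually_elim (simp add: h_def convergent_LIMSEQ_iff)
  have bound: "AE x in M. norm (g m x) \<le> B" for m
    using K(2)[OF g(1)] by auto
  have int_h: "integrable M h" and lim_int: "(\<lambda>m. LINT x|M. g m x) \<longlonglongrightarrow> (LINT x|M. h x)"
    using integrable_dominated_convergence[of h M g "\<lambda>_. B"]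
      integral_dominated_convergence[of h M g "\<lambda>_. B"] lim bound by auto
  have mean_h: "(LINT x|M. h x) = (LINT x|M. f x)"
    using lim_int K(3)[OF g(1)] by (simp add: LIMSEQ_const_iff)
  \<comment> \<open>\<open>g m \<circ> T\<close> is as nearly minimal as \<open>g m\<close>, so the two share their limit, which is thus invariant\<close>
  have "AE x in M. summable (\<lambda>m. g m x - g m (T x))"
  proof (rule AE_summable_if_summable_L1_norms[OF _ summ])
    show "(LINT x|M. \<bar>g m x - g m (T x)\<bar>) \<le> 2 * (1/2) ^ m" for m
      using g gT by (intro close) auto
    show "integrable M (\<lambda>x. g m x - g m (T x))" for m
      by (intro Bochner_Integration.integrable_diff int_g bounded_measurable_integrable[OF K(4)[OF gT(1)]])
  qed
  moreover have "AE x in M. (\<lambda>m. g m (T x)) \<longlonglongrightarrow> h (T x)"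
    using AE_iterate[OF lim, of 1] by simp
  ultimately have "AE x in M. h (T x) = h x" using lim
  proof eventually_elim
    case (elim x)
    have "(\<lambda>m. g m x - g m (T x)) \<longlonglongrightarrow> 0" by (rule summable_LIMSEQ_zero[OF elim(1)])
    moreover have "(\<lambda>m. g m x - g m (T x)) \<longlonglongrightarrow> h x - h (T x)"
      by (intro tendsto_diff elim)
    ultimately show ?case using LIMSEQ_unique by fastforce
  qed
  from ergodic_AE_constant[OF erg int_h this]
  have h_const: "AE x in M. h x = (LINT x|M. f x)" by (simp add: mean_h)
  have "(\<lambda>m. LINT x|M. \<bar>g m x - (LINT x|M. f x)\<bar>) \<longlonglongrightarrow> (LINT x|M. 0)"
  proof (rule integral_dominated_convergence[where w = "\<lambda>_. B + \<bar>LINT x|M. f x\<bar>"])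
    show "AE x in M. (\<lambda>m. \<bar>g m x - (LINT x|M. f x)\<bar>) \<longlonglongrightarrow> 0"
      using lim h_const by eventually_elim (auto intro: tendsto_rabs_zero simp: LIM_zero_iff)
    show "AE x in M. norm \<bar>g m x - (LINT x|M. f x)\<bar> \<le> B + \<bar>LINT x|M. f x\<bar>" for m
      using bound[of m] by eventually_elim auto
  qed auto
  then have "eventually (\<lambda>m. (LINT x|M. \<bar>g m x - (LINT x|M. f x)\<bar>) < e) sequentially"
    using \<open>e > 0\<close> by (intro order_tendstoD(2)) auto
  then show ?thesis using g(1) by (meson eventually_happens trivial_limit_sequentially)
qed

text \<open>
  Averages of correlations with \<open>f\<close> agree asymptotically with those of an element \<open>g\<close> of the hull
  of its orbit, and choosing \<open>g\<close> close to a constant makes every single correlation small.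
\<close>

theorem mean_ergodic:
  fixes f w :: "'a \<Rightarrow> real"
  assumes F: "folner_sequence F" and erg: "ergodic T M"
    and f: "bounded_measurable M f" and w: "bounded_measurable M w"
  shows "average F (correlation M T f w) \<longlonglongrightarrow> 0"
proof (rule LIMSEQ_I)
  fix r :: real assume "r > 0"
  obtain C where C: "w \<in> borel_measurable M" "\<And>x. x \<in> space M \<Longrightarrow> norm (w x) \<le> C" "C \<ge> 0"
    by (metis bounded_measurableE w)
  let ?a = "LINT x|M. f x"
  \<comment> \<open>the \<open>+ 1\<close> only avoids a division by zero when \<open>w\<close> vanishes\<close>
  have "r / (4 * (C + 1)) > 0" using \<open>r > 0\<close> C by simp
  from orbit_hull_L1_near_mean[OF erg f this] obtain g where g: "g \<in> orbit_hull T f"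
    and ga: "(LINT x|M. \<bar>g x - ?a\<bar>) < r / (4 * (C + 1))" by blast
  obtain B where "f \<in> borel_measurable M" "\<And>x. x \<in> space M \<Longrightarrow> norm (f x) \<le> B"
    by (metis bounded_measurableE f)
  then have "bounded_measurable M g"
    using orbit_hull_bounded[of f B g] g by (auto simp: bounded_measurable_def)
  then have int_g: "integrable M g" by (rule bounded_measurable_integrable)
  have small: "norm (correlation M T g w j) \<le> r / 2" for j
  proof -
    have "norm (correlation M T g w j) = norm (correlation M T (\<lambda>x. g x - ?a) w j)"
      by (simp add: correlation_minus_const[OF int_g w])
    also have "\<dots> \<le> 2 * C * (LINT x|M. norm (g x - ?a))"
      by (rule correlation_le_L1_left) (use int_g C in auto)
    also have "\<dots> \<le> 2 * C * (r / (4 * (C + 1)))"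
      using ga C by (intro mult_left_mono) auto
    also have "\<dots> \<le> r / 2" using C \<open>r > 0\<close> by (simp add: field_simps)
    finally show ?thesis .
  qed
  have "eventually (\<lambda>n. \<bar>average F (correlation M T g w) n - average F (correlation M T f w) n\<bar> < r / 2) sequentially"
    using order_tendstoD(2)[OF tendsto_rabs_zero[OF average_correlation_orbit_hull[OF F f w g]], of "r / 2"]
      \<open>r > 0\<close> by simp
  then have "eventually (\<lambda>n. norm (average F (correlation M T f w) n - 0) < r) sequentially"
    using folner_eventually[OF F]
  proof eventually_elim
    case (elim n)
    have "norm (average F (correlation M T g w) n) \<le> r / 2"
      by (rule norm_average_le) (use small elim in auto)
    then show ?case using elim by (simp add: abs_if split: if_splits)
  qed
  then show "\<exists>N. \<forall>n\<ge>N. norm (average F (correlation M T f w) n - 0) < r"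
    by (simp add: eventually_sequentially)
qed

end

section \<open>Mixing along a set of times\<close>

text \<open>
  The common consequence of the two mixing hypotheses.  It only produces single good times, which
  suffices because the correlations to which it is applied are either constant on \<open>A\<close> or
  restricted to two values.
\<close>

definition mixes_along :: "'a measure \<Rightarrow> ('a \<Rightarrow> 'a) \<Rightarrow> nat set \<Rightarrow> bool"
  where "mixes_along M T A \<longleftrightarrow> (\<forall>f g :: 'a \<Rightarrow> complex.
    bounded_measurable M f \<longrightarrow> bounded_measurable M g \<longrightarrow>
    (\<forall>\<eta>>0. \<exists>j\<in>A. norm (correlation M T f g j) < \<eta>))"

lemma bounded_measurable_Re_Im:
  assumes "bounded_measurable M f"
  shows "bounded_measurable M (\<lambda>x. Re (f x))" "bounded_measurable M (\<lambda>x. Im (f x))"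
proof -
  obtain B where B: "f \<in> borel_measurable M" "\<And>x. x \<in> space M \<Longrightarrow> norm (f x) \<le> B"
    using bounded_measurableE[OF assms] by metis
  note [measurable] = B(1)
  have "norm (Re (f x)) \<le> B" "norm (Im (f x)) \<le> B" if "x \<in> space M" for x
    using B(2)[OF that] abs_Re_le_cmod[of "f x"] abs_Im_le_cmod[of "f x"] by simp_all
  then show "bounded_measurable M (\<lambda>x. Re (f x))" "bounded_measurable M (\<lambda>x. Im (f x))"
    unfolding bounded_measurable_def by auto
qed

context measure_preserving_system
begin

lemma Re_correlation:
  assumes f: "bounded_measurable M f" and g: "bounded_measurable M g"
  shows "Re (correlation M T f g j) =
    correlation M T (\<lambda>x. Re (f x)) (\<lambda>x. Re (g x)) j - correlation M T (\<lambda>x. Im (f x)) (\<lambda>x. Im (g x)) j"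
proof -
  note f' = bounded_measurable_Re_Im[OF f] and g' = bounded_measurable_Re_Im[OF g]
  note int = bounded_measurable_integrable
  have "Re (LINT x|M. f ((T ^^ j) x) * g x)
      = (LINT x|M. Re (f ((T ^^ j) x)) * Re (g x) - Im (f ((T ^^ j) x)) * Im (g x))"
    using integrable_correlation_left[OF int[OF f] g, of j]
    by (subst integral_Re[symmetric]) auto
  also have "\<dots> = (LINT x|M. Re (f ((T ^^ j) x)) * Re (g x)) - (LINT x|M. Im (f ((T ^^ j) x)) * Im (g x))"
    by (intro Bochner_Integration.integral_diff
          integrable_correlation_left[OF int[OF f'(1)] g'(1)] integrable_correlation_left[OF int[OF f'(2)] g'(2)])
  finally show ?thesis using int[OF f] int[OF g] by (simp add: correlation_def)
qed

lemma Im_correlation: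
  assumes f: "bounded_measurable M f" and g: "bounded_measurable M g"
  shows "Im (correlation M T f g j) =
    correlation M T (\<lambda>x. Re (f x)) (\<lambda>x. Im (g x)) j + correlation M T (\<lambda>x. Im (f x)) (\<lambda>x. Re (g x)) j"
proof -
  note f' = bounded_measurable_Re_Im[OF f] and g' = bounded_measurable_Re_Im[OF g]
  note int = bounded_measurable_integrable
  have "Im (LINT x|M. f ((T ^^ j) x) * g x)
      = (LINT x|M. Re (f ((T ^^ j) x)) * Im (g x) + Im (f ((T ^^ j) x)) * Re (g x))"
    using integrable_correlation_left[OF int[OF f] g, of j]
    by (subst integral_Im[symmetric]) auto
  also have "\<dots> = (LINT x|M. Re (f ((T ^^ j) x)) * Im (g x)) + (LINT x|M. Im (f ((T ^^ j) x)) * Re (g x))"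
    by (intro Bochner_Integration.integral_add
          integrable_correlation_left[OF int[OF f'(1)] g'(2)] integrable_correlation_left[OF int[OF f'(2)] g'(1)])
  finally show ?thesis using int[OF f] int[OF g] by (simp add: correlation_def)
qed

lemma mean_ergodic_complex:
  fixes f g :: "'a \<Rightarrow> complex"
  assumes F: "folner_sequence F" and erg: "ergodic T M"
    and f: "bounded_measurable M f" and g: "bounded_measurable M g"
  shows "average F (correlation M T f g) \<longlonglongrightarrow> 0"
proof -
  note f' = bounded_measurable_Re_Im[OF f] and g' = bounded_measurable_Re_Im[OF g]
  note met = mean_ergodic[OF F erg]
  have "Re (average F (correlation M T f g) n) =
      average F (correlation M T (\<lambda>x. Re (f x)) (\<lambda>x. Re (g x))) n
      - average F (correlation M T (\<lambda>x. Im (f x)) (\<lambda>x. Im (g x))) n" for n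
    by (simp add: average_def Re_correlation[OF f g] sum_subtractf right_diff_distrib)
  moreover have "Im (average F (correlation M T f g) n) =
      average F (correlation M T (\<lambda>x. Re (f x)) (\<lambda>x. Im (g x))) n
      + average F (correlation M T (\<lambda>x. Im (f x)) (\<lambda>x. Re (g x))) n" for n
    by (simp add: average_def Im_correlation[OF f g] sum.distrib distrib_left)
  ultimately show ?thesis
    using tendsto_diff[OF met[OF f'(1) g'(1)] met[OF f'(2) g'(2)]]
      tendsto_add[OF met[OF f'(1) g'(2)] met[OF f'(2) g'(1)]]
    by (simp add: tendsto_complex_iff)
qed

section \<open>Weak mixing\<close>

lemma integral_tensor_square:
  fixes u :: "'a \<Rightarrow> real"
  assumes "bounded_measurable M u"
  shows "(LINT z|(M \<Otimes>\<^sub>M M). u (fst z) * u (snd z)) = (LINT x|M. u x)\<^sup>2"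
proof -
  interpret P: pair_prob_space M M ..
  obtain B where B: "u \<in> borel_measurable M" "\<And>x. x \<in> space M \<Longrightarrow> norm (u x) \<le> B" "B \<ge> 0"
    using bounded_measurableE[OF assms] by metis
  note [measurable] = B(1)
  have "\<bar>u x * u y\<bar> \<le> B * B" if "x \<in> space M" "y \<in> space M" for x y
    using B that by (auto simp: abs_mult intro: mult_mono)
  then have "integrable (M \<Otimes>\<^sub>M M) (\<lambda>z. u (fst z) * u (snd z))"
    by (intro P.integrable_const_bound[of _ "B * B"]) (auto simp: space_pair_measure intro!: AE_I2)
  from P.integral_fst'[OF this] show ?thesis
    using bounded_measurable_integrable[OF assms] by (simp add: power2_eq_square)
qed

text \<open>
  A strictly invariant set \<open>B\<close> gives the strictly invariant set \<open>B \<times> space M\<close> of the same measure.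
\<close>

lemma weakly_mixing_imp_ergodic:
  assumes "weakly_mixing T M" shows "ergodic T M"
  unfolding ergodic_def
proof (intro conjI ballI impI)
  interpret P: pair_prob_space M M ..
  fix B assume B: "B \<in> sets M" "T -` B \<inter> space M = B"
  have "map_prod T T -` (B \<times> space M) \<inter> space (M \<Otimes>\<^sub>M M) = B \<times> space M"
  proof (rule set_eqI)
    fix z :: "'a \<times> 'a"
    obtain a b where z: "z = (a, b)" by (cases z)
    have "a \<in> B \<longleftrightarrow> T a \<in> B \<and> a \<in> space M" using B(2) by blast
    moreover have "b \<in> space M \<Longrightarrow> T b \<in> space M" by (rule measurable_space[OF T_measurable])
    ultimately show "z \<in> map_prod T T -` (B \<times> space M) \<inter> space (M \<Otimes>\<^sub>M M) \<longleftrightarrow> z \<in> B \<times> space M"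
      unfolding z by (simp add: space_pair_measure) blast
  qed
  then have "(measure (M \<Otimes>\<^sub>M M) (B \<times> space M))\<^sup>2 = measure (M \<Otimes>\<^sub>M M) (B \<times> space M)"
    using assms B(1) by (auto simp: weakly_mixing_def ergodic_def)
  moreover have "measure (M \<Otimes>\<^sub>M M) (B \<times> space M) = prob B"
    using B(1) by (simp add: measure_def emeasure_pair_measure_Times emeasure_space_1)
  ultimately show "(prob B)\<^sup>2 = prob B" by simp
qed (rule T_invariant)

text \<open>
  The square of \<open>LINT x|M. f (T\<^sup>j x) * g x\<close> is an integral over the product system, which is
  ergodic.  So both this square and the integral itself converge on average to the values expected
  under independence, and the square of their difference converges on average to zero.
\<close>

lemma average_correlation_power2:
  fixes f g :: "'a \<Rightarrow> real"
  assumes F: "folner_sequence F" and wm: "weakly_mixing T M"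
    and f: "bounded_measurable M f" and g: "bounded_measurable M g"
  shows "average F (\<lambda>j. (correlation M T f g j)\<^sup>2) \<longlonglongrightarrow> 0"
proof -
  interpret P: pair_prob_space M M ..
  have TT [measurable]: "map_prod T T \<in> measurable (M \<Otimes>\<^sub>M M) (M \<Otimes>\<^sub>M M)"
    unfolding map_prod_def by measurable
  have erg: "ergodic (map_prod T T) (M \<Otimes>\<^sub>M M)" using wm by (simp add: weakly_mixing_def)
  interpret Q: measure_preserving_system "M \<Otimes>\<^sub>M M" "map_prod T T"
    by unfold_locales (use erg in \<open>simp_all add: ergodic_def TT\<close>)
  have iter: "(map_prod T T ^^ j) z = ((T ^^ j) (fst z), (T ^^ j) (snd z))" for j z
    by (induction j) (auto simp: map_prod_def split_beta)
  have tensor: "bounded_measurable (M \<Otimes>\<^sub>M M) (\<lambda>z. u (fst z) * u (snd z))"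
    if "bounded_measurable M u" for u :: "'a \<Rightarrow> real"
    by (rule bounded_measurable_mult)
       (use that in \<open>auto simp: bounded_measurable_def space_pair_measure\<close>)
  let ?f = "\<lambda>z. f (fst z) * f (snd z)" and ?g = "\<lambda>z. g (fst z) * g (snd z)"
  define a where "a = (LINT x|M. f x) * (LINT x|M. g x)"
  have corr: "correlation (M \<Otimes>\<^sub>M M) (map_prod T T) ?f ?g j
      = (LINT x|M. f ((T ^^ j) x) * g x)\<^sup>2 - a\<^sup>2" for j
  proof -
    have "(LINT z|(M \<Otimes>\<^sub>M M). ?f ((map_prod T T ^^ j) z) * ?g z)
        = (LINT z|(M \<Otimes>\<^sub>M M). (f ((T ^^ j) (fst z)) * g (fst z)) * (f ((T ^^ j) (snd z)) * g (snd z)))"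
      by (simp add: iter mult_ac)
    also have "\<dots> = (LINT x|M. f ((T ^^ j) x) * g x)\<^sup>2"
      by (rule integral_tensor_square)
         (intro bounded_measurable_mult bounded_measurable_iterate f g)
    finally show ?thesis
      by (simp add: correlation_def integral_tensor_square f g a_def power_mult_distrib)
  qed
  have sq: "(correlation M T f g j)\<^sup>2
      = correlation (M \<Otimes>\<^sub>M M) (map_prod T T) ?f ?g j + (- 2 * a) *\<^sub>R correlation M T f g j" for j
    unfolding corr by (simp add: correlation_def a_def power2_eq_square algebra_simps)
  have "(\<lambda>n. average F (correlation (M \<Otimes>\<^sub>M M) (map_prod T T) ?f ?g) n
        + (- 2 * a) *\<^sub>R average F (correlation M T f g) n) \<longlonglongrightarrow> 0 + (- 2 * a) *\<^sub>R 0"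
    by (intro tendsto_add tendsto_scaleR tendsto_const
          Q.mean_ergodic[OF F erg] tensor mean_ergodic[OF F weakly_mixing_imp_ergodic[OF wm]] f g)
  then show ?thesis unfolding sq average_add average_scaleR by simp
qed

text \<open>
  Averages of squared correlations vanish, and finitely many such averages can be added: this gives
  one time in \<open>A\<close> that is good for all four correlations of real and imaginary parts.
\<close>

lemma weakly_mixing_imp_mixes_along:
  assumes wm: "weakly_mixing T M" and F: "folner_sequence F" and A: "upper_density F A > 0"
  shows "mixes_along M T A"
  unfolding mixes_along_def
proof (intro allI impI)
  fix f g :: "'a \<Rightarrow> complex" and \<eta> :: real
  assume f: "bounded_measurable M f" and g: "bounded_measurable M g" and "\<eta> > 0"
  note f' = bounded_measurable_Re_Im[OF f] and g' = bounded_measurable_Re_Im[OF g]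
  let ?rr = "correlation M T (\<lambda>x. Re (f x)) (\<lambda>x. Re (g x))"
  let ?ii = "correlation M T (\<lambda>x. Im (f x)) (\<lambda>x. Im (g x))"
  let ?ri = "correlation M T (\<lambda>x. Re (f x)) (\<lambda>x. Im (g x))"
  let ?ir = "correlation M T (\<lambda>x. Im (f x)) (\<lambda>x. Re (g x))"
  define b where "b j = (?rr j)\<^sup>2 + (?ii j)\<^sup>2 + ((?ri j)\<^sup>2 + (?ir j)\<^sup>2)" for j
  note sq = average_correlation_power2[OF F wm]
  have "(\<lambda>n. average F (\<lambda>j. (?rr j)\<^sup>2) n + average F (\<lambda>j. (?ii j)\<^sup>2) n
      + (average F (\<lambda>j. (?ri j)\<^sup>2) n + average F (\<lambda>j. (?ir j)\<^sup>2) n)) \<longlonglongrightarrow> 0 + 0 + (0 + 0)"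
    by (intro tendsto_add sq f' g')
  then have "average F b \<longlonglongrightarrow> 0"
    unfolding b_def[abs_def] average_add by simp
  then obtain j where j: "j \<in> A" "b j < \<eta>\<^sup>2 / 2"
    using small_value_on_positive_upper_density[OF F A, of b "\<eta>\<^sup>2 / 2"] \<open>\<eta> > 0\<close>
    by (auto simp: b_def)
  have "(norm (correlation M T f g j))\<^sup>2 = (?rr j - ?ii j)\<^sup>2 + (?ri j + ?ir j)\<^sup>2"
    by (simp add: cmod_power2 Re_correlation[OF f g] Im_correlation[OF f g])
  also have "\<dots> \<le> 2 * b j"
    using sum_squares_bound[of "?ri j" "?ir j"] sum_squares_bound[of "?rr j" "- ?ii j"]
    by (simp add: b_def power2_eq_square algebra_simps)
  also have "\<dots> < \<eta>\<^sup>2" using j by simp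
  finally have "norm (correlation M T f g j) < \<eta>"
    by (rule power_less_imp_less_base) (use \<open>\<eta> > 0\<close> in simp)
  with j show "\<exists>j\<in>A. norm (correlation M T f g j) < \<eta>" by blast
qed

section \<open>Strong mixing\<close>

lemma correlation_add_left:
  fixes f f' g :: "'a \<Rightarrow> 'b::{real_normed_field, banach, second_countable_topology}"
  assumes "integrable M f" "integrable M f'" "bounded_measurable M g"
  shows "correlation M T (\<lambda>x. f x + f' x) g j = correlation M T f g j + correlation M T f' g j"
  using integrable_correlation_left[OF assms(1,3), of j] integrable_correlation_left[OF assms(2,3), of j] assms
  by (simp add: correlation_def distrib_right)

lemma correlation_add_right:
  fixes f g g' :: "'a \<Rightarrow> 'b::{real_normed_field, banach, second_countable_topology}"
  assumes "bounded_measurable M f" "integrable M g" "integrable M g'"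
  shows "correlation M T f (\<lambda>x. g x + g' x) j = correlation M T f g j + correlation M T f g' j"
  using integrable_correlation_right[OF assms(1,2), of j] integrable_correlation_right[OF assms(1,3), of j] assms
  by (simp add: correlation_def distrib_left)

end

lemma tendsto_zero_if_uniformly_approximable:
  fixes c :: "nat \<Rightarrow> 'b::real_normed_vector"
  assumes "\<And>i. b i \<longlonglongrightarrow> 0" "\<And>i j. norm (c j - b i j) \<le> e i" "e \<longlonglongrightarrow> (0::real)"
  shows "c \<longlonglongrightarrow> 0"
proof (rule LIMSEQ_I)
  fix r :: real assume "r > 0"
  have "eventually (\<lambda>i. e i < r / 2) sequentially"
    using assms(3) \<open>r > 0\<close> by (intro order_tendstoD(2)) auto
  then obtain i where i: "e i < r / 2" by (meson eventually_happens trivial_limit_sequentially)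
  obtain N where N: "\<And>j. j \<ge> N \<Longrightarrow> norm (b i j - 0) < r / 2"
    using LIMSEQ_D[OF assms(1)] \<open>r > 0\<close> by (metis half_gt_zero)
  have "norm (c j - 0) < r" if "j \<ge> N" for j
    using N[OF that] assms(2)[of j i] i norm_triangle_ineq[of "c j - b i j" "b i j"] by simp
  then show "\<exists>N. \<forall>j\<ge>N. norm (c j - 0) < r" by blast
qed

lemma dominated_L1_convergence:
  fixes f :: "'a \<Rightarrow> 'b::{banach, second_countable_topology}"
  assumes s: "\<And>i. integrable M (s i)" and f: "integrable M f"
    and lim: "\<And>x. x \<in> space M \<Longrightarrow> (\<lambda>i. s i x) \<longlonglongrightarrow> f x"
    and bound: "\<And>i x. x \<in> space M \<Longrightarrow> norm (s i x) \<le> 2 * norm (f x)"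
  shows "(\<lambda>i. LINT x|M. norm (f x - s i x)) \<longlonglongrightarrow> 0"
proof -
  note [measurable] = borel_measurable_integrable[OF s] borel_measurable_integrable[OF f]
  have "(\<lambda>i. LINT x|M. norm (f x - s i x)) \<longlonglongrightarrow> (LINT x|M. 0)"
  proof (rule integral_dominated_convergence[where w = "\<lambda>x. 3 * norm (f x)"])
    show "AE x in M. (\<lambda>i. norm (f x - s i x)) \<longlonglongrightarrow> 0"
      using lim by (intro AE_I2 tendsto_norm_zero) (auto intro!: tendsto_eq_intros)
    show "AE x in M. norm (norm (f x - s i x)) \<le> 3 * norm (f x)" for i
    proof (rule AE_I2)
      fix x assume "x \<in> space M"
      then show "norm (norm (f x - s i x)) \<le> 3 * norm (f x)"
        using bound[of x i] norm_triangle_ineq4[of "f x" "s i x"] by simp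
    qed
  qed (use f in auto)
  then show ?thesis by simp
qed

context measure_preserving_system
begin

lemma integral_indicator_scaleR:
  fixes c :: "'b::{banach, second_countable_topology}"
  assumes "S \<in> sets M"
  shows "(LINT x|M. indicator S x *\<^sub>R c) = prob S *\<^sub>R c"
proof -
  have "(LINT x|M. indicator S x *\<^sub>R c) = (LINT x|M. indicator S x) *\<^sub>R c"
    using assms by (intro integral_scaleR_left integrable_real_indicator) (auto simp: emeasure_eq_measure)
  then show ?thesis using sets.sets_into_space[OF assms] by (simp add: Int_absorb2)
qed

text \<open>
  The definition is the case of two indicator functions.  It extends to all bounded functions by
  linearity and \<open>L\<^sup>1\<close> approximation, one factor after the other, because correlations are controlled
  uniformly in time by the \<open>L\<^sup>1\<close> norm of one factor and the supremum of the other.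
\<close>

lemma strongly_mixing_correlation:
  fixes f g :: "'a \<Rightarrow> complex"
  assumes sm: "strongly_mixing T M" and f: "bounded_measurable M f" and g: "bounded_measurable M g"
  shows "correlation M T f g \<longlonglongrightarrow> 0"
proof -
  have one_set: "correlation M T u (\<lambda>x. indicator B x *\<^sub>R c) \<longlonglongrightarrow> 0"
    if u: "integrable M u" and B: "B \<in> sets M" for u :: "'a \<Rightarrow> complex" and B and c :: complex
    using u
  proof (induction rule: integrable_induct)
    case (base A d)
    have "(LINT x|M. (indicator A ((T ^^ j) x) *\<^sub>R d) * (indicator B x *\<^sub>R c))
        = measure M (((T ^^ j) -` A \<inter> space M) \<inter> B) *\<^sub>R (d * c)" for j
    proof -
      have S: "((T ^^ j) -` A \<inter> space M) \<inter> B \<in> sets M"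
        using base B measurable_sets[OF measurable_compose_n[OF T_measurable]] by blast
      have "(LINT x|M. (indicator A ((T ^^ j) x) *\<^sub>R d) * (indicator B x *\<^sub>R c))
          = (LINT x|M. indicator (((T ^^ j) -` A \<inter> space M) \<inter> B) x *\<^sub>R (d * c))"
        by (intro Bochner_Integration.integral_cong) (auto simp: indicator_def)
      then show ?thesis by (simp only: integral_indicator_scaleR[OF S])
    qed
    then have eq: "correlation M T (\<lambda>x. indicator A x *\<^sub>R d) (\<lambda>x. indicator B x *\<^sub>R c) j
        = (measure M (((T ^^ j) -` A \<inter> space M) \<inter> B) - measure M A * measure M B) *\<^sub>R (d * c)" for j
      using base B by (simp add: correlation_def scaleR_diff_left integral_indicator_scaleR)
    have "(\<lambda>j. (measure M (((T ^^ j) -` A \<inter> space M) \<inter> B) - measure M A * measure M B) *\<^sub>R (d * c))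
        \<longlonglongrightarrow> (measure M A * measure M B - measure M A * measure M B) *\<^sub>R (d * c)"
      using sm base B by (intro tendsto_intros) (simp add: strongly_mixing_def)
    then show ?case unfolding eq[abs_def] by simp
  next
    case (add u v)
    have bB: "bounded_measurable M (\<lambda>x. indicator B x *\<^sub>R c)"
      using B by (auto simp: bounded_measurable_def indicator_def intro!: exI[of _ "norm c"])
    show ?case
      using tendsto_add[OF add.IH] correlation_add_left[OF add.hyps bB] by simp
  next
    case (lim u s)
    note ints = \<open>\<And>i. integrable M (s i)\<close>
    have bB: "bounded_measurable M (\<lambda>x. indicator B x *\<^sub>R c)"
      and nB: "\<And>x. norm (indicator B x *\<^sub>R c) \<le> norm c"
      using B by (auto simp: bounded_measurable_def indicator_def intro!: exI[of _ "norm c"])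
    show ?case
    proof (rule tendsto_zero_if_uniformly_approximable)
      fix i j
      have "correlation M T u (\<lambda>x. indicator B x *\<^sub>R c) j
          = correlation M T (s i) (\<lambda>x. indicator B x *\<^sub>R c) j
          + correlation M T (\<lambda>x. u x - s i x) (\<lambda>x. indicator B x *\<^sub>R c) j"
        using correlation_add_left[OF ints[of i] _ bB, of "\<lambda>x. u x - s i x"] ints[of i] lim by simp
      moreover have "norm (correlation M T (\<lambda>x. u x - s i x) (\<lambda>x. indicator B x *\<^sub>R c) j)
          \<le> 2 * norm c * (LINT x|M. norm (u x - s i x))"
        using lim bB nB ints[of i] by (intro correlation_le_L1_left) (auto simp: bounded_measurable_def)
      ultimately show "norm (correlation M T u (\<lambda>x. indicator B x *\<^sub>R c) j
          - correlation M T (s i) (\<lambda>x. indicator B x *\<^sub>R c) j)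
          \<le> 2 * norm c * (LINT x|M. norm (u x - s i x))" by simp
    next
      show "(\<lambda>i. 2 * norm c * (LINT x|M. norm (u x - s i x))) \<longlonglongrightarrow> 0"
        by (intro tendsto_mult_right_zero dominated_L1_convergence) (use lim in auto)
    qed (use lim in auto)
  qed
  obtain C where C: "f \<in> borel_measurable M" "\<And>x. x \<in> space M \<Longrightarrow> norm (f x) \<le> C" "C \<ge> 0"
    using bounded_measurableE[OF f] by metis
  show ?thesis
    using bounded_measurable_integrable[OF g]
  proof (induction rule: integrable_induct)
    case (base B c)
    show ?case by (rule one_set[OF bounded_measurable_integrable[OF f] base(1)])
  next
    case (add u v)
    show ?case
      using tendsto_add[OF add.IH] correlation_add_right[OF f add.hyps] by simp
  next
    case (lim u s)
    note ints = \<open>\<And>i. integrable M (s i)\<close>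
    show ?case
    proof (rule tendsto_zero_if_uniformly_approximable)
      fix i j
      have "correlation M T f u j = correlation M T f (s i) j + correlation M T f (\<lambda>x. u x - s i x) j"
        using correlation_add_right[OF f ints[of i], of "\<lambda>x. u x - s i x"] ints[of i] lim by simp
      moreover have "norm (correlation M T f (\<lambda>x. u x - s i x) j) \<le> 2 * C * (LINT x|M. norm (u x - s i x))"
        using lim C ints[of i] by (intro correlation_le_L1_right) auto
      ultimately show "norm (correlation M T f u j - correlation M T f (s i) j)
          \<le> 2 * C * (LINT x|M. norm (u x - s i x))" by simp
    next
      show "(\<lambda>i. 2 * C * (LINT x|M. norm (u x - s i x))) \<longlonglongrightarrow> 0"
        by (intro tendsto_mult_right_zero dominated_L1_convergence) (use lim in auto)
    qed (use lim in auto)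
  qed
qed

lemma strongly_mixing_imp_mixes_along:
  assumes sm: "strongly_mixing T M" and A: "infinite A"
  shows "mixes_along M T A"
  unfolding mixes_along_def
proof (intro allI impI)
  fix f g :: "'a \<Rightarrow> complex" and \<eta> :: real
  assume "bounded_measurable M f" "bounded_measurable M g" "\<eta> > 0"
  then obtain N where N: "\<And>j. j \<ge> N \<Longrightarrow> norm (correlation M T f g j) < \<eta>"
    using LIMSEQ_D[OF strongly_mixing_correlation[OF sm], of f g \<eta>] by auto
  obtain j where "j \<in> A" "j \<ge> N" using A by (meson infinite_nat_iff_unbounded_le)
  with N show "\<exists>j\<in>A. norm (correlation M T f g j) < \<eta>" by blast
qed

section \<open>Atoms\<close>

text \<open>
  The measure of \<open>T\<^sup>-\<^sup>j {x} \<inter> {x}\<close> is either \<open>0\<close> or the mass \<open>m\<close> of the atom, so it can only come close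
  to \<open>m\<^sup>2\<close> if \<open>m\<close> is \<open>0\<close> or \<open>1\<close>.
\<close>

lemma atom_of_mixing_has_full_measure:
  assumes mix: "mixes_along M T A" and x: "{x} \<in> sets M" "prob {x} \<noteq> 0"
  shows "prob {x} = 1"
proof (rule ccontr)
  assume ne1: "prob {x} \<noteq> 1"
  define m where "m = prob {x}"
  have m: "0 < m" "m < 1"
    using x ne1 prob_le_1[of "{x}"] measure_nonneg[of M "{x}"] unfolding m_def by linarith+
  let ?f = "\<lambda>y. complex_of_real (indicator {x} y)"
  have bf: "bounded_measurable M ?f"
    using x by (auto simp: bounded_measurable_def indicator_def intro!: exI[of _ 1])
  have corr: "correlation M T ?f ?f j = of_real (measure M (((T ^^ j) -` {x} \<inter> space M) \<inter> {x}) - m\<^sup>2)" for j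
  proof -
    have S: "((T ^^ j) -` {x} \<inter> space M) \<inter> {x} \<in> sets M"
      using x measurable_sets[OF measurable_compose_n[OF T_measurable]] by blast
    have "(LINT y|M. ?f ((T ^^ j) y) * ?f y)
        = (LINT y|M. complex_of_real (indicator (((T ^^ j) -` {x} \<inter> space M) \<inter> {x}) y))"
      by (intro Bochner_Integration.integral_cong) (auto simp: indicator_def)
    also have "\<dots> = of_real (measure M (((T ^^ j) -` {x} \<inter> space M) \<inter> {x}))"
      using sets.sets_into_space[OF S] by (simp add: Int_absorb2)
    finally show ?thesis
      using sets.sets_into_space[OF x(1)]
      by (simp add: correlation_def m_def power2_eq_square Int_absorb2)
  qed
  have val: "measure M (((T ^^ j) -` {x} \<inter> space M) \<inter> {x}) \<in> {0, m}" for j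
  proof -
    have "((T ^^ j) -` {x} \<inter> space M) \<inter> {x} = {} \<or> ((T ^^ j) -` {x} \<inter> space M) \<inter> {x} = {x}"
      by (rule subset_singletonD) (rule Int_lower2)
    then show ?thesis
      by (elim disjE) (simp_all only: m_def measure_empty insert_iff simp_thms)
  qed
  have pos: "min (m\<^sup>2) (m - m\<^sup>2) > 0"
    using m by (simp add: power2_eq_square)
  obtain j where "norm (correlation M T ?f ?f j) < min (m\<^sup>2) (m - m\<^sup>2)"
    using mix bf pos unfolding mixes_along_def by blast
  then have "\<bar>measure M (((T ^^ j) -` {x} \<inter> space M) \<inter> {x}) - m\<^sup>2\<bar> < min (m\<^sup>2) (m - m\<^sup>2)"
    unfolding corr norm_of_real .
  with val[of j] show False by auto
qed

end

section \<open>Fourier coefficients on the circle\<close>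

lemma cis_eq_1_iff_Ints: "cis (2 * pi * t) = 1 \<longleftrightarrow> t \<in> \<int>"
proof
  assume "cis (2 * pi * t) = 1"
  then have "cos (2 * pi * t) = 1" by (metis cis.sel(1) one_complex.sel(1))
  then obtain n :: int where "2 * pi * t = of_int n * 2 * pi"
    by (auto simp: cos_one_2pi_int)
  then have "t = of_int n" by simp
  then show "t \<in> \<int>" by simp
qed simp

lift_definition character :: "int \<Rightarrow> circle \<Rightarrow> complex" is "\<lambda>k x. cis (2 * pi * (of_int k * x))"
proof -
  fix k :: int and x y :: real assume "x - y \<in> \<int>"
  then have "of_int k * (x - y) \<in> \<int>" by simp
  then have "cis (2 * pi * (of_int k * (x - y))) = 1" by (simp only: cis_eq_1_iff_Ints)
  moreover have "cis (2 * pi * (of_int k * x))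
      = cis (2 * pi * (of_int k * (x - y))) * cis (2 * pi * (of_int k * y))"
    by (simp add: cis_mult algebra_simps)
  ultimately show "cis (2 * pi * (of_int k * x)) = cis (2 * pi * (of_int k * y))" by simp
qed

lemma character_to_circle: "character k (to_circle x) = cis (2 * pi * (of_int k * x))"
  by (rule character.abs_eq)

lemma norm_character [simp]: "norm (character k c) = 1"
  by (cases c rule: circle_exhaust) (simp add: character_to_circle)

lemma character_0 [simp]: "character 0 c = 1"
  by (cases c rule: circle_exhaust) (simp add: character_to_circle)

lemma character_mult: "character k c * character m c = character (k + m) c"
  by (cases c rule: circle_exhaust) (simp add: character_to_circle cis_mult algebra_simps)

lemma cnj_character: "cnj (character k c) = character (- k) c"
  by (cases c rule: circle_exhaust) (simp add: character_to_circle cis_cnj)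

lemma character_times_map: "character k (times_map q c) = character (k * q) c"
  by (cases c rule: circle_exhaust) (simp add: character_to_circle times_map.abs_eq mult.assoc)

lemma character_1_eq_iff: "character 1 c = character 1 d \<longleftrightarrow> c = d"
proof -
  obtain x y where xy: "c = to_circle x" "d = to_circle y" by (metis circle_exhaust)
  have "character 1 c = character 1 d \<longleftrightarrow> cis (2 * pi * (x - y)) = 1"
    by (simp add: xy character_to_circle right_diff_distrib flip: cis_divide)
  also have "\<dots> \<longleftrightarrow> c = d" by (simp only: cis_eq_1_iff_Ints xy to_circle_eq_iff)
  finally show ?thesis .
qed

lemma times_map_funpow: "times_map p ^^ j = times_map (p ^ j)"
proof (induction j)
  case 0
  have "times_map 1 c = c" for c
    by (cases c rule: circle_exhaust) (simp add: times_map.abs_eq)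
  then show ?case by (simp add: fun_eq_iff)
next
  case (Suc j)
  have "times_map p (times_map (p ^ j) c) = times_map (p ^ Suc j) c" for c
    by (cases c rule: circle_exhaust) (simp add: times_map.abs_eq mult.assoc)
  then show ?case by (simp add: Suc fun_eq_iff)
qed

lemma continuous_character: "continuous_on UNIV (character k)"
proof -
  have "open (character k -` U)" if "open U" for U
  proof -
    have "to_circle -` character k -` U = (\<lambda>x. cis (2 * pi * (of_int k * x))) -` U"
      by (auto simp: character_to_circle)
    moreover have "open ((\<lambda>x. cis (2 * pi * (of_int k * x))) -` U)"
      using that by (rule open_vimage) (intro continuous_intros)
    ultimately show ?thesis by (simp add: open_circle_def)
  qed
  then show ?thesis by (simp add: continuous_on_open_vimage)
qed

lemma UNIV_circle: "UNIV = to_circle ` {0..<1}"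
proof -
  have "c \<in> to_circle ` {0..<1}" for c
  proof -
    obtain x where x: "c = to_circle x" by (rule circle_exhaust)
    have "c = to_circle (frac x)" by (simp add: x to_circle_eq_iff frac_def)
    then show ?thesis by (simp add: frac_lt_1)
  qed
  then show ?thesis by blast
qed

lemma compact_UNIV_circle: "compact (UNIV :: circle set)"
proof -
  have "compact (to_circle ` {0..1})"
    by (rule compact_continuous_image) (auto intro: continuous_on_subset[OF continuous_to_circle])
  moreover have "to_circle ` {0..1} = UNIV"
    using UNIV_circle by force
  ultimately show ?thesis by simp
qed

text \<open>
  These are the roots of unity whose order divides \<open>m\<close>.  The range of numerators below covers both signs of \<open>m\<close>.
\<close>

lemma character_eq_1_finite:
  assumes "m \<noteq> 0" shows "finite {c. character m c = 1}"
proof -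
  have "{c. character m c = 1} \<subseteq> to_circle ` (\<lambda>i. of_int i / of_int m) ` {- \<bar>m\<bar>..\<bar>m\<bar>}"
  proof
    fix c assume "c \<in> {c. character m c = 1}"
    moreover obtain x where x: "x \<in> {0..<1}" "c = to_circle x"
      using UNIV_circle by (metis UNIV_I imageE)
    ultimately have "of_int m * x \<in> \<int>"
      by (simp add: character_to_circle cis_eq_1_iff_Ints)
    then obtain i where i: "of_int m * x = of_int i" by (auto elim: Ints_cases)
    have "\<bar>of_int m * x\<bar> \<le> \<bar>of_int m\<bar> * 1"
      unfolding abs_mult using x by (intro mult_left_mono) auto
    then have "\<bar>of_int i :: real\<bar> \<le> of_int \<bar>m\<bar>" using i by simp
    then have "\<bar>i\<bar> \<le> \<bar>m\<bar>" by linarith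
    moreover have "x = of_int i / of_int m" using i assms by (simp add: field_simps)
    ultimately have "x \<in> (\<lambda>i. of_int i / of_int m) ` {- \<bar>m\<bar>..\<bar>m\<bar>}"
      by (intro image_eqI[of _ _ i]) auto
    then show "c \<in> to_circle ` (\<lambda>i. of_int i / of_int m) ` {- \<bar>m\<bar>..\<bar>m\<bar>}"
      unfolding x(2) by (rule imageI)
  qed
  then show ?thesis by (rule finite_subset) simp
qed

definition fourier :: "circle measure \<Rightarrow> int \<Rightarrow> complex"
  where "fourier \<mu> k = (LINT x|\<mu>. character k x)"

lemma continuous_circle_bounded_measurable:
  fixes f :: "circle \<Rightarrow> 'b::real_normed_vector"
  assumes "sets \<mu> = sets borel" "continuous_on UNIV f"
  shows "bounded_measurable \<mu> f"
proof -
  have "bounded (range f)"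
    using compact_continuous_image[OF assms(2) compact_UNIV_circle] by (rule compact_imp_bounded)
  then obtain B where "\<And>x. norm (f x) \<le> B" by (auto simp: bounded_iff)
  moreover have "f \<in> borel_measurable \<mu>"
    using borel_measurable_continuous_onI[OF assms(2)] measurable_cong_sets[OF assms(1) refl] by blast
  ultimately show ?thesis by (auto simp: bounded_measurable_def)
qed

section \<open>Uniqueness of Fourier coefficients\<close>

text \<open>
  The trigonometric polynomials, in the form that makes rule induction reduce integrals to
  Fourier coefficients.
\<close>

inductive_set trig_poly :: "(circle \<Rightarrow> complex) set" where
  monomial: "(\<lambda>x. c * character k x) \<in> trig_poly"
| add: "f \<in> trig_poly \<Longrightarrow> g \<in> trig_poly \<Longrightarrow> (\<lambda>x. f x + g x) \<in> trig_poly"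

lemma trig_poly_mult_monomial:
  assumes "g \<in> trig_poly" shows "(\<lambda>x. c * character k x * g x) \<in> trig_poly"
  using assms
proof induction
  case (monomial d m)
  have "(\<lambda>x. c * character k x * (d * character m x)) = (\<lambda>x. (c * d) * character (k + m) x)"
    by (simp add: character_mult[symmetric] mult_ac)
  then show ?case using trig_poly.monomial by metis
next
  case (add f g)
  then show ?case using trig_poly.add by (simp add: distrib_left)
qed

lemma trig_poly_mult:
  assumes "f \<in> trig_poly" "g \<in> trig_poly" shows "(\<lambda>x. f x * g x) \<in> trig_poly"
  using assms(1)
proof induction
  case (monomial c k)
  then show ?case using trig_poly_mult_monomial[OF assms(2)] .
next
  case (add f h)
  then show ?case using trig_poly.add by (simp add: distrib_right)
qed

lemma trig_poly_continuous: "f \<in> trig_poly \<Longrightarrow> continuous_on UNIV f"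
  by (induction rule: trig_poly.induct) (auto intro!: continuous_intros continuous_character)

lemma trig_poly_const: "(\<lambda>_. c) \<in> trig_poly"
  using trig_poly.monomial[of c 0] by simp

lemma trig_poly_integral_eq:
  assumes \<mu>: "borel_probability \<mu>" and \<nu>: "borel_probability \<nu>"
    and eq: "\<And>k. fourier \<mu> k = fourier \<nu> k" and f: "f \<in> trig_poly"
  shows "(LINT x|\<mu>. f x) = (LINT x|\<nu>. f x)"
  using f
proof induction
  case (monomial c k)
  show ?case using eq[of k] by (simp add: fourier_def)
next
  case (add f g)
  interpret m: prob_space \<mu> using \<mu> by (simp add: borel_probability_def)
  interpret n: prob_space \<nu> using \<nu> by (simp add: borel_probability_def)
  have "integrable \<mu> h" "integrable \<nu> h" if "h \<in> trig_poly" for h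
    using \<mu> \<nu> continuous_circle_bounded_measurable[OF _ trig_poly_continuous[OF that]]
    by (auto simp: borel_probability_def
             intro: m.bounded_measurable_integrable n.bounded_measurable_integrable)
  then show ?case using add by simp
qed

text \<open>
  The first character is injective, and its real and imaginary parts are trigonometric polynomials.
\<close>

lemma real_trig_poly_separates:
  assumes "c \<noteq> d"
  shows "\<exists>f. (\<lambda>x. complex_of_real (f x)) \<in> trig_poly \<and> f c \<noteq> f d"
proof -
  let ?Re = "\<lambda>x. Re (character 1 x)" and ?Im = "\<lambda>x. Im (character 1 x)"
  have "(\<lambda>x. (1/2) * character 1 x + (1/2) * character (-1) x) \<in> trig_poly"
    by (intro trig_poly.intros)
  moreover have "(\<lambda>x. complex_of_real (?Re x)) = (\<lambda>x. (1/2) * character 1 x + (1/2) * character (-1) x)"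
    by (simp add: fun_eq_iff complex_eq_iff flip: cnj_character)
  ultimately have Re: "(\<lambda>x. complex_of_real (?Re x)) \<in> trig_poly" by simp
  have "(\<lambda>x. (- \<i>/2) * character 1 x + (\<i>/2) * character (-1) x) \<in> trig_poly"
    by (intro trig_poly.intros)
  moreover have "(\<lambda>x. complex_of_real (?Im x)) = (\<lambda>x. (- \<i>/2) * character 1 x + (\<i>/2) * character (-1) x)"
    by (simp add: fun_eq_iff complex_eq_iff flip: cnj_character)
  ultimately have Im: "(\<lambda>x. complex_of_real (?Im x)) \<in> trig_poly" by simp
  have "character 1 c \<noteq> character 1 d" using assms by (simp add: character_1_eq_iff)
  then have "?Re c \<noteq> ?Re d \<or> ?Im c \<noteq> ?Im d" by (simp add: complex_eq_iff)
  then show ?thesis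
  proof
    assume "?Re c \<noteq> ?Re d"
    with Re show ?thesis by (intro exI[of _ ?Re] conjI)
  next
    assume "?Im c \<noteq> ?Im d"
    with Im show ?thesis by (intro exI[of _ ?Im] conjI)
  qed
qed

lemma function_ring_trig_poly:
  "function_ring_on {f. (\<lambda>x. complex_of_real (f x)) \<in> trig_poly} (UNIV :: circle set)"
proof
  fix f g :: "circle \<Rightarrow> real"
  assume f: "f \<in> {f. (\<lambda>x. complex_of_real (f x)) \<in> trig_poly}"
  then have "continuous_on UNIV (\<lambda>x. Re (complex_of_real (f x)))"
    by (intro continuous_on_Re trig_poly_continuous) simp
  then show "continuous_on UNIV f" by simp
  assume g: "g \<in> {f. (\<lambda>x. complex_of_real (f x)) \<in> trig_poly}"
  show "(\<lambda>x. f x + g x) \<in> {f. (\<lambda>x. complex_of_real (f x)) \<in> trig_poly}"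
    using trig_poly.add f g by fastforce
  show "(\<lambda>x. f x * g x) \<in> {f. (\<lambda>x. complex_of_real (f x)) \<in> trig_poly}"
    using trig_poly_mult f g by fastforce
next
  show "\<exists>f\<in>{f. (\<lambda>x. complex_of_real (f x)) \<in> trig_poly}. f c \<noteq> f d" if "c \<noteq> d" for c d
    using real_trig_poly_separates[OF that] by blast
qed (auto simp: compact_UNIV_circle trig_poly_const)

lemma continuous_integral_eq:
  fixes f :: "circle \<Rightarrow> real"
  assumes \<mu>: "borel_probability \<mu>" and \<nu>: "borel_probability \<nu>"
    and eq: "\<And>k. fourier \<mu> k = fourier \<nu> k" and f: "continuous_on UNIV f"
  shows "(LINT x|\<mu>. f x) = (LINT x|\<nu>. f x)"
proof (rule ccontr)
  interpret R: function_ring_on "{f. (\<lambda>x. complex_of_real (f x)) \<in> trig_poly}" "UNIV :: circle set"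
    by (rule function_ring_trig_poly)
  assume ne: "\<not> ?thesis"
  define e where "e = \<bar>(LINT x|\<mu>. f x) - (LINT x|\<nu>. f x)\<bar> / 3"
  have e_eq: "3 * e = \<bar>(LINT x|\<mu>. f x) - (LINT x|\<nu>. f x)\<bar>" by (simp add: e_def)
  have e: "e > 0" using ne by (simp add: e_def)
  from R.Stone_Weierstrass_basic[OF f e] obtain g
    where g: "(\<lambda>x. complex_of_real (g x)) \<in> trig_poly" and close: "\<And>x. \<bar>f x - g x\<bar> < e" by auto
  have gc: "continuous_on UNIV g" by (rule R.continuous) (use g in simp)
  have "\<bar>(LINT x|m. f x) - (LINT x|m. g x)\<bar> \<le> e" if m: "borel_probability m" for m
  proof -
    interpret m: prob_space m using m by (simp add: borel_probability_def)
    have int: "integrable m f" "integrable m g"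
      using m f gc by (auto simp: borel_probability_def
        intro!: m.bounded_measurable_integrable continuous_circle_bounded_measurable)
    have "norm (LINT x|m. f x - g x) \<le> (LINT x|m. e)"
      using int close by (intro norm_integral_le) (auto intro: less_imp_le)
    then show ?thesis using int by (simp add: m.prob_space)
  qed
  from this[OF \<mu>] this[OF \<nu>] have "3 * e \<le> 2 * e + \<bar>(LINT x|\<mu>. g x) - (LINT x|\<nu>. g x)\<bar>"
    using e_eq by linarith
  moreover have "(LINT x|\<mu>. g x) = (LINT x|\<nu>. g x)"
    using trig_poly_integral_eq[OF \<mu> \<nu> eq g] by simp
  ultimately show False using e by simp
qed

text \<open>
  Indicators of open sets are limits of continuous functions.  The first character embeds the circle
  into the plane and so provides a distance to the complement of \<open>U\<close>, which is positive exactly on \<open>U\<close>.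
\<close>

lemma measure_open_eq:
  assumes \<mu>: "borel_probability \<mu>" and \<nu>: "borel_probability \<nu>"
    and eq: "\<And>k. fourier \<mu> k = fourier \<nu> k" and U: "open U"
  shows "measure \<mu> U = measure \<nu> U"
\<comment> \<open>the distance to an empty complement would be \<open>0\<close> instead of positive\<close>
proof (cases "U = UNIV")
  case True
  have "measure m UNIV = 1" if "borel_probability m" for m :: "circle measure"
    using that prob_space.prob_space[of m] sets_eq_imp_space_eq[of m borel]
    by (simp add: borel_probability_def)
  then show ?thesis using \<mu> \<nu> True by simp
next
  case False
  define K where "K = character 1 ` (- U)"
  have "compact (- U)"
    using compact_UNIV_circle U by (metis closed_Int_compact inf_top_right open_closed closed_Compl)
  then have "compact K" unfolding K_def
    by (intro compact_continuous_image continuous_on_subset[OF continuous_character]) auto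
  then have K: "closed K" "K \<noteq> {}" using False by (auto simp: K_def compact_imp_closed)
  have K_iff: "character 1 x \<in> K \<longleftrightarrow> x \<notin> U" for x
    by (auto simp: K_def character_1_eq_iff)
  define f where "f n x = min 1 (real n * infdist (character 1 x) K)" for n x
  have f_cont: "continuous_on UNIV (f n)" for n
    unfolding f_def by (intro continuous_intros continuous_character)
  have f_bound: "norm (f n x) \<le> 1" for n x
    by (simp add: f_def infdist_nonneg)
  have f_lim: "(\<lambda>n. f n x) \<longlonglongrightarrow> indicator U x" for x
  proof (cases "x \<in> U")
    case True
    then have pos: "infdist (character 1 x) K > 0"
      using K K_iff by (intro infdist_pos_not_in_closed) auto
    obtain N :: nat where "1 / infdist (character 1 x) K < real N"
      using reals_Archimedean2 by blast
    then have N: "1 < real N * infdist (character 1 x) K" using pos by (simp add: field_simps)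
    have "f n x = 1" if "n \<ge> N" for n
    proof -
      have "real N * infdist (character 1 x) K \<le> real n * infdist (character 1 x) K"
        using that pos by (intro mult_right_mono) auto
      then show ?thesis using N by (simp add: f_def)
    qed
    then show ?thesis using True by (auto intro!: tendsto_eventually eventually_sequentiallyI[of N])
  next
    case False
    then have "infdist (character 1 x) K = 0"
      using K K_iff in_closed_iff_infdist_zero by blast
    then show ?thesis using False by (simp add: f_def)
  qed
  have lim: "(\<lambda>n. LINT x|m. f n x) \<longlonglongrightarrow> measure m U" if m: "borel_probability m" for m
  proof -
    interpret m: prob_space m using m by (simp add: borel_probability_def)
    have sets: "sets m = sets borel" using m by (simp add: borel_probability_def)
    have [measurable]: "U \<in> sets m" using U sets by simp
    have [measurable]: "f n \<in> borel_measurable m" for n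
      using continuous_circle_bounded_measurable[OF sets f_cont] by (simp add: bounded_measurable_def)
    have "(\<lambda>n. LINT x|m. f n x) \<longlonglongrightarrow> (LINT x|m. indicator U x)"
      by (rule integral_dominated_convergence[where w = "\<lambda>_. 1"])
         (use f_lim f_bound in auto)
    then show ?thesis using sets_eq_imp_space_eq[OF sets] by simp
  qed
  show ?thesis
    using LIMSEQ_unique[OF lim[OF \<mu>]] lim[OF \<nu>] continuous_integral_eq[OF \<mu> \<nu> eq f_cont] by simp
qed

theorem fourier_unique:
  assumes \<mu>: "borel_probability \<mu>" and \<nu>: "borel_probability \<nu>"
    and eq: "\<And>k. fourier \<mu> k = fourier \<nu> k"
  shows "\<mu> = \<nu>"
proof (rule measure_eqI_generator_eq[where E = "Collect open" and \<Omega> = UNIV and A = "\<lambda>_. UNIV"])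
  interpret m: prob_space \<mu> using \<mu> by (simp add: borel_probability_def)
  interpret n: prob_space \<nu> using \<nu> by (simp add: borel_probability_def)
  have gen: "sets (borel :: circle measure) = sigma_sets UNIV (Collect open)"
    by (simp add: borel_def)
  show "sets \<mu> = sigma_sets UNIV (Collect open)" "sets \<nu> = sigma_sets UNIV (Collect open)"
    using \<mu> \<nu> gen by (auto simp: borel_probability_def)
  show "emeasure \<mu> U = emeasure \<nu> U" if "U \<in> Collect open" for U
    using measure_open_eq[OF \<mu> \<nu> eq, of U] that
    by (simp add: m.emeasure_eq_measure n.emeasure_eq_measure)
  show "emeasure \<mu> UNIV \<noteq> \<infinity>" by (simp add: m.emeasure_eq_measure)
qed (auto simp: Int_stable_def)

section \<open>Lebesgue measure\<close>

lemma borel_probability_lebesgue_circle: "borel_probability lebesgue_circle"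
proof -
  have "prob_space (restrict_space lborel {0..<1::real})"
    by (rule prob_spaceI) (simp add: emeasure_restrict_space space_restrict_space)
  moreover have meas: "to_circle \<in> measurable (restrict_space lborel {0..<1}) borel"
    using borel_measurable_continuous_onI[OF continuous_to_circle]
    by (intro measurable_restrict_space1) simp
  ultimately show ?thesis
    unfolding borel_probability_def lebesgue_circle_def by (auto intro: prob_space.prob_space_distr)
qed

lemma fourier_lebesgue_circle:
  assumes "k \<noteq> 0" shows "fourier lebesgue_circle k = 0"
proof -
  define a where "a = \<i> * (2 * of_real pi * of_int k)"
  have a: "a \<noteq> 0" using assms by (simp add: a_def)
  have char: "cis (2 * pi * (of_int k * x)) = exp (a * of_real x)" for x
    by (simp add: cis_conv_exp a_def mult_ac)
  have meas: "to_circle \<in> measurable (restrict_space lborel {0..<1}) borel"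
    using borel_measurable_continuous_onI[OF continuous_to_circle]
    by (intro measurable_restrict_space1) simp
  have "fourier lebesgue_circle k = (LINT x|restrict_space lborel {0..<1}. exp (a * of_real x))"
    unfolding fourier_def lebesgue_circle_def
    by (subst integral_distr[OF meas])
       (auto simp: character_to_circle char intro: borel_measurable_continuous_onI continuous_character)
  also have "\<dots> = (LINT x|lborel. indicator {0..<1} x *\<^sub>R exp (a * of_real x))"
    by (rule integral_restrict_space) simp
  also have "\<dots> = (LINT x|lborel. indicator {0..1} x *\<^sub>R exp (a * of_real x))"
  proof (rule integral_cong_AE)
    show "AE x in lborel. indicator {0..<1::real} x *\<^sub>R exp (a * of_real x)
        = indicator {0..1} x *\<^sub>R exp (a * of_real x)"
      using AE_lborel_singleton[of 1] by eventually_elim (auto simp: indicator_def)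
  qed measurable
  also have "\<dots> = exp (a * of_real 1) / a - exp (a * of_real 0) / a"
  proof (rule integral_FTC_Icc)
    show "((\<lambda>x. exp (a * of_real x) / a) has_vector_derivative exp (a * of_real x))
        (at x within {0..1})" for x :: real
      by (rule has_vector_derivative_real_field) (auto intro!: derivative_eq_intros simp: a)
    show "continuous_on {0..1} (\<lambda>x. exp (a * complex_of_real x))"
      by (intro continuous_intros)
  qed simp
  also have "exp (a * of_real 1) = 1" using char[of 1] by simp
  finally show ?thesis by simp
qed

section \<open>The rigidity theorem\<close>

lemma circle_system:
  assumes "borel_probability \<mu>" "invariant_measure (times_map q) \<mu>"
  shows "measure_preserving_system \<mu> (times_map q)"
proof -
  interpret prob_space \<mu> using assms(1) by (simp add: borel_probability_def)
  have sets: "sets \<mu> = sets borel" using assms(1) by (simp add: borel_probability_def)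
  show ?thesis
    using borel_measurable_continuous_onI[OF continuous_times_map, of q] assms(2)
    by unfold_locales (auto simp: measurable_cong_sets[OF sets sets])
qed

lemma fourier_times_map:
  assumes "borel_probability \<mu>" "invariant_measure (times_map q) \<mu>"
  shows "fourier \<mu> (k * q) = fourier \<mu> k"
proof -
  interpret measure_preserving_system \<mu> "times_map q" by (rule circle_system[OF assms])
  have "character k \<in> borel_measurable \<mu>"
    using continuous_circle_bounded_measurable[OF _ continuous_character] assms(1)
    by (simp add: borel_probability_def bounded_measurable_def)
  from integral_iterate[OF this, of 1] show ?thesis
    by (simp add: fourier_def character_times_map)
qed

text \<open>
  The identity that drives the proof: since \<open>k (p\<^sup>j + l) = k p\<^sup>j + k l\<close>, invariance under multiplication
  by \<open>p\<^sup>j + l\<close> turns the correlation of two characters at time \<open>j\<close> into a number that does not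
  depend on \<open>j\<close>.
\<close>

lemma correlation_characters:
  assumes \<mu>: "borel_probability \<mu>" and inv: "invariant_measure (times_map (p ^ j + l)) \<mu>"
  shows "correlation \<mu> (times_map p) (character k) (character (k * l)) j
    = fourier \<mu> k - fourier \<mu> k * fourier \<mu> (k * l)"
proof -
  have "(LINT x|\<mu>. character k ((times_map p ^^ j) x) * character (k * l) x) = fourier \<mu> (k * (p ^ j + l))"
    by (simp add: fourier_def times_map_funpow character_times_map character_mult distrib_left)
  then show ?thesis
    by (simp add: correlation_def fourier_times_map[OF \<mu> inv]) (simp add: fourier_def)
qed

text \<open>
  A mean of unimodular numbers can only be \<open>1\<close> if almost all of them are, so \<open>\<mu>\<close> lives on finitely many roots
  of unity.
\<close>

lemma atom_if_fourier_eq_1: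
  assumes \<mu>: "borel_probability \<mu>" and m: "m \<noteq> 0" "fourier \<mu> m = 1"
  shows "\<exists>x. measure \<mu> {x} \<noteq> 0"
proof (rule ccontr)
  assume "\<not> ?thesis"
  then have null: "measure \<mu> {x} = 0" for x by blast
  interpret prob_space \<mu> using \<mu> by (simp add: borel_probability_def)
  have sets: "sets \<mu> = sets borel" using \<mu> by (simp add: borel_probability_def)
  have int: "integrable \<mu> (character m)"
    by (intro bounded_measurable_integrable continuous_circle_bounded_measurable sets continuous_character)
  have Re_le: "0 \<le> 1 - Re (character m x)" for x
    using complex_Re_le_cmod[of "character m x"] by simp
  have "(LINT x|\<mu>. 1 - Re (character m x)) = 0"
    using int m(2) by (simp add: fourier_def prob_space)
  then have "AE x in \<mu>. 1 - Re (character m x) = 0"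
    using int Re_le by (subst (asm) integral_nonneg_eq_0_iff_AE) auto
  then have "AE x in \<mu>. x \<in> {c. character m c = 1}"
  proof eventually_elim
    case (elim x)
    then have "(Im (character m x))\<^sup>2 = 0"
      using norm_character[of m x] by (simp add: cmod_def)
    with elim show ?case by (simp add: complex_eq_iff)
  qed
  moreover have "AE x in \<mu>. \<forall>c\<in>{c. character m c = 1}. x \<noteq> c"
  proof (rule AE_finite_allI[OF character_eq_1_finite[OF m(1)]])
    fix c
    have "{c} \<in> null_sets \<mu>"
      using null[of c] sets by (simp add: null_sets_def emeasure_eq_measure)
    from AE_not_in[OF this] show "AE x in \<mu>. x \<noteq> c" by simp
  qed
  ultimately have "AE x in \<mu>. False" by eventually_elim blast
  then show False by simp
qed

text \<open>
  If some \<open>fourier \<mu> k\<close> with \<open>k \<noteq> 0\<close> does not vanish, it can be cancelled, and the coefficient at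
  \<open>k * l \<noteq> 0\<close> equals \<open>1\<close>.
\<close>

lemma lebesgue_or_atom:
  assumes \<mu>: "borel_probability \<mu>" and l: "l \<noteq> 0"
    and eq: "\<And>k. fourier \<mu> k = fourier \<mu> k * fourier \<mu> (k * l)"
  shows "\<mu> = lebesgue_circle \<or> (\<exists>x. measure \<mu> {x} \<noteq> 0)"
proof (cases "\<exists>k. k \<noteq> 0 \<and> fourier \<mu> k \<noteq> 0")
  case True
  then obtain k where "k \<noteq> 0" "fourier \<mu> k \<noteq> 0" by blast
  then have "k * l \<noteq> 0" "fourier \<mu> (k * l) = 1" using eq[of k] l by auto
  then show ?thesis using atom_if_fourier_eq_1[OF \<mu>] by blast
next
  case False
  have zero: "fourier m 0 = 1" if "borel_probability m" for m
    using that prob_space.prob_space[of m] by (simp add: fourier_def borel_probability_def)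
  have "fourier \<mu> k = fourier lebesgue_circle k" for k
    using False fourier_lebesgue_circle zero[OF \<mu>] zero[OF borel_probability_lebesgue_circle]
    by (cases "k = 0") auto
  then show ?thesis using fourier_unique[OF \<mu> borel_probability_lebesgue_circle] by blast
qed

text \<open>
  The correlation of two characters is constant on a set of density one, while the mean ergodic
  theorem makes its average vanish: so the constant is zero.
\<close>

lemma ergodic_condition_fourier:
  assumes \<mu>: "borel_probability \<mu>" and inv: "invariant_measure (times_map p) \<mu>"
    and cond: "ergodic_condition p \<mu>"
  shows "\<exists>l\<noteq>0. \<forall>k. fourier \<mu> k = fourier \<mu> k * fourier \<mu> (k * l)"
proof -
  interpret measure_preserving_system \<mu> "times_map p" by (rule circle_system[OF \<mu> inv])
  obtain l F A where erg: "ergodic (times_map p) \<mu>" and l: "l \<noteq> 0" and F: "folner_sequence F"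
    and A: "has_density F A 1" "\<And>j. j \<in> A \<Longrightarrow> invariant_measure (times_map (p ^ j + l)) \<mu>"
    using cond by (auto simp: ergodic_condition_def)
  have "fourier \<mu> k - fourier \<mu> k * fourier \<mu> (k * l) = 0" for k
  proof -
    let ?c = "correlation \<mu> (times_map p) (character k) (character (k * l))"
    have b: "bounded_measurable \<mu> (character i)" for i
      using \<mu> by (intro continuous_circle_bounded_measurable continuous_character)
        (simp add: borel_probability_def)
    have "average F ?c \<longlonglongrightarrow> 0" by (rule mean_ergodic_complex[OF F erg b b])
    moreover have "average F ?c \<longlonglongrightarrow> fourier \<mu> k - fourier \<mu> k * fourier \<mu> (k * l)"
    proof (rule average_eq_on_density_one[OF F A(1)])
      show "norm (?c j) \<le> 2 * 1 * (LINT x|\<mu>. norm (character k x))" for j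
        using b[of "k * l"] bounded_measurable_integrable[OF b[of k]]
        by (intro correlation_le_L1_left) (auto simp: bounded_measurable_def)
      show "?c j = fourier \<mu> k - fourier \<mu> k * fourier \<mu> (k * l)" if "j \<in> A" for j
        by (rule correlation_characters[OF \<mu> A(2)[OF that]])
    qed
    ultimately show ?thesis by (metis LIMSEQ_unique)
  qed
  with l show ?thesis by auto
qed

lemma mixes_along_fourier:
  assumes \<mu>: "borel_probability \<mu>" and mix: "mixes_along \<mu> (times_map p) A"
    and A: "\<And>j. j \<in> A \<Longrightarrow> invariant_measure (times_map (p ^ j + l)) \<mu>"
  shows "fourier \<mu> k = fourier \<mu> k * fourier \<mu> (k * l)"
proof (rule ccontr)
  assume ne: "\<not> ?thesis"
  let ?\<eta> = "norm (fourier \<mu> k - fourier \<mu> k * fourier \<mu> (k * l))"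
  have b: "bounded_measurable \<mu> (character i)" for i
    using \<mu> by (intro continuous_circle_bounded_measurable continuous_character)
      (simp add: borel_probability_def)
  have "?\<eta> > 0" using ne by simp
  then obtain j where "j \<in> A"
    "norm (correlation \<mu> (times_map p) (character k) (character (k * l)) j) < ?\<eta>"
    using mix b unfolding mixes_along_def by blast
  then show False using correlation_characters[OF \<mu> A] by auto
qed

lemma mixing_conditions:
  assumes \<mu>: "borel_probability \<mu>" and inv: "invariant_measure (times_map p) \<mu>"
    and cond: "weakly_mixing_condition p \<mu> \<or> strongly_mixing_condition p \<mu>"
  obtains l A where "l \<noteq> 0" "mixes_along \<mu> (times_map p) A"
    "\<And>j. j \<in> A \<Longrightarrow> invariant_measure (times_map (p ^ j + l)) \<mu>"
proof -
  interpret measure_preserving_system \<mu> "times_map p" by (rule circle_system[OF \<mu> inv])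
  show ?thesis
    using cond that weakly_mixing_imp_mixes_along strongly_mixing_imp_mixes_along
    unfolding weakly_mixing_condition_def strongly_mixing_condition_def by metis
qed

lemma dirac_if_point_mass_1:
  assumes \<mu>: "borel_probability \<mu>" and x: "measure \<mu> {x} = 1"
  shows "\<mu> = return borel x"
proof (rule measure_eqI)
  interpret prob_space \<mu> using \<mu> by (simp add: borel_probability_def)
  have sets: "sets \<mu> = sets borel" using \<mu> by (simp add: borel_probability_def)
  show "sets \<mu> = sets (return borel x)" by (simp add: sets)
  fix B assume B: "B \<in> sets \<mu>"
  have "AE y in \<mu>. y \<in> {x}" by (rule AE_prob_1[OF x])
  then have "AE y in \<mu>. y \<in> B \<longleftrightarrow> y \<in> (if x \<in> B then space \<mu> else {})"
    using AE_space by eventually_elim auto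
  then have "emeasure \<mu> B = emeasure \<mu> (if x \<in> B then space \<mu> else {})"
    using B by (intro emeasure_eq_AE) auto
  then show "emeasure \<mu> B = emeasure (return borel x) B"
    using B sets by (simp add: emeasure_space_1)
qed

theorem theorem5p1:
  fixes p :: int
  shows "(\<forall>\<mu> :: circle measure.
            borel_probability \<mu> \<and> non_atomic \<mu> \<and> invariant_measure (times_map p) \<mu> \<and>
            (ergodic_condition p \<mu> \<or> weakly_mixing_condition p \<mu> \<or> strongly_mixing_condition p \<mu>)
            \<longrightarrow> \<mu> = lebesgue_circle) \<and>
         (\<forall>\<mu> :: circle measure.
            borel_probability \<mu> \<and> invariant_measure (times_map p) \<mu> \<and>
            (weakly_mixing_condition p \<mu> \<or> strongly_mixing_condition p \<mu>)
            \<longrightarrow> (\<exists>x. \<mu> = return borel x) \<or> \<mu> = lebesgue_circle)"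
proof (intro conjI allI impI)
  fix \<mu> :: "circle measure"
  assume H: "borel_probability \<mu> \<and> non_atomic \<mu> \<and> invariant_measure (times_map p) \<mu> \<and>
    (ergodic_condition p \<mu> \<or> weakly_mixing_condition p \<mu> \<or> strongly_mixing_condition p \<mu>)"
  then have \<mu>: "borel_probability \<mu>" and inv: "invariant_measure (times_map p) \<mu>" by auto
  have "\<exists>l\<noteq>0. \<forall>k. fourier \<mu> k = fourier \<mu> k * fourier \<mu> (k * l)"
  proof (cases "ergodic_condition p \<mu>")
    case True
    then show ?thesis by (rule ergodic_condition_fourier[OF \<mu> inv])
  next
    case False
    then have "weakly_mixing_condition p \<mu> \<or> strongly_mixing_condition p \<mu>" using H by blast
    then show ?thesis
      by (rule mixing_conditions[OF \<mu> inv]) (use mixes_along_fourier[OF \<mu>] in blast)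
  qed
  then show "\<mu> = lebesgue_circle"
    using lebesgue_or_atom[OF \<mu>] H unfolding non_atomic_def by blast
next
  fix \<mu> :: "circle measure"
  assume H: "borel_probability \<mu> \<and> invariant_measure (times_map p) \<mu> \<and>
    (weakly_mixing_condition p \<mu> \<or> strongly_mixing_condition p \<mu>)"
  then have \<mu>: "borel_probability \<mu>" and inv: "invariant_measure (times_map p) \<mu>"
    and cond: "weakly_mixing_condition p \<mu> \<or> strongly_mixing_condition p \<mu>" by auto
  interpret measure_preserving_system \<mu> "times_map p" by (rule circle_system[OF \<mu> inv])
  obtain l A where l: "l \<noteq> 0" and mix: "mixes_along \<mu> (times_map p) A"
    and A: "\<And>j. j \<in> A \<Longrightarrow> invariant_measure (times_map (p ^ j + l)) \<mu>"
    using mixing_conditions[OF \<mu> inv cond] by metis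
  have "fourier \<mu> k = fourier \<mu> k * fourier \<mu> (k * l)" for k
    by (rule mixes_along_fourier[OF \<mu> mix A])
  from lebesgue_or_atom[OF \<mu> l this]
  show "(\<exists>x. \<mu> = return borel x) \<or> \<mu> = lebesgue_circle"
  proof
    assume "\<exists>x. measure \<mu> {x} \<noteq> 0"
    then obtain x where x: "measure \<mu> {x} \<noteq> 0" by blast
    have "{x} \<in> sets \<mu>" using \<mu> by (simp add: borel_probability_def)
    from atom_of_mixing_has_full_measure[OF mix this x] have "\<mu> = return borel x"
      by (rule dirac_if_point_mass_1[OF \<mu>])
    then show ?thesis by blast
  qed (rule disjI2)
qed

end
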